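(* Let $t_1,\ldots,t_n\in\mathbb{R}^d$ be fixed, $\mathbf{t}=(t_1,\ldots,t_n)$. For $\mathbb{P}_{Z(\mathbf{t})}$-a.e. $\mathbf{z}>\mathbf{0}$, we have: 1. for all $\mathbf{n}\in N_1$, $$\mathbb{P}(E_{\mathbf{n}}(Z(\mathbf{t}))\mid Z(\mathbf{t})=\mathbf{z})=\lim_{m\to\infty}\mathbb{P}(E^{(m)}_{\mathbf{n}}(\mathbf{z})\mid Z(\mathbf{t})\in A_m(\mathbf{z}));$$ 2. for any integers $0\le k\le l$, any Borel sets $B_j\subset S$ and any $r_j\in\mathbb{N}_0$, $j\in\{1,\ldots,l\}$, $$\mathbb{P}\big(|\Pi_2\cap B_j|=r_j,\ 1\le j\le k,\ |\Pi_3\cap B_j|=r_j,\ k<j\le l\ \big|\ Z(\mathbf{t})=\mathbf{z}\big)$$ $$=\lim_{m\to\infty}\mathbb{P}\big(|\Pi\cap K^{(m)}_{\mathbf{t},\mathbf{z}}\cap B_j|=r_j,\ 1\le j\le k,\ |\Pi\cap B_j\setminus(K^{(m)}_{\mathbf{t},\mathbf{z}}\cup\overline{K_{\mathbf{t},\mathbf{z}}}^{(m)})|=r_j,\ k<j\le l\ \big|\ Z(\mathbf{t})\in A_m(\mathbf{z})\big).$$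
   Context: Let $G$ be a countable set of measurable functions $f:\mathbb{R}^d\to[0,\infty)$, with $\sigma$-algebra $2^G$, and let $F$ be a $G$-valued random function with law $\mathbb{P}_F$ such that $\mathbb{E}\left(\int_{\mathbb{R}^d}F(x)\,\mathrm{d}x\right)=1$. Let $S=\mathbb{R}^d\times(0,\infty)\times G$, and let $\Pi$ be a Poisson point process on $S$ with intensity measure $\Lambda(A\times B\times C)=\mu(A)\,\mathbb{P}_F(C)\int_B u^{-2}\,\mathrm{d}u$, where $\mu$ is Lebesgue measure. Define $Z(t)=\max_{(s,u,f)\in\Pi}u f(t-s)$, $t\in\mathbb{R}^d$. Write $Z(\mathbf{t})=(Z(t_1),\ldots,Z(t_n))$, let $\mathbb{P}_{Z(\mathbf{t})}$ be its law, and let $\mathbb{P}(\cdot\mid Z(\mathbf{t})=\mathbf{z})$ be a regular conditional probability on $\sigma(\Pi)$ given $Z(\mathbf{t})=\mathbf{z}$. Vector inequalities are componentwise, $\mathbb{N}_0=\mathbb{N}\cup\{0\}$, and $|\cdot|$ is the number of points. For $\mathbf{z}\in(0,\infty)^n$ (convention $z/0=\infty$ for $z>0$): $K_{\mathbf{t},\mathbf{z}}=\{(x,y,f)\in S: y=\min_{i} z_i/f(t_i-x)\}$; $\overline{K_{\mathbf{t},\mathbf{z}}}=\{(x,y,f)\in S: y f(t_j-x)>z_j\text{ for some }j\}$; $\Pi_1=\Pi\cap\overline{K_{\mathbf{t},Z(\mathbf{t})}}$, $\Pi_2=\Pi\cap K_{\mathbf{t},Z(\mathbf{t})}$, $\Pi_3=\Pi\setminus(\Pi_1\cup\Pi_2)$.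 Let $\mathcal{A}=2^{\{1,\ldots,n\}}\setminus\{\emptyset\}$ and, for $A\in\mathcal{A}$, $I_A(\mathbf{z})=\{(x,y,f)\in S: y f(t_i-x)=z_i,\ i\in A,\ y f(t_j-x)<z_j,\ j\notin A\}$. Blurred sets: for $z>0$, $m\in\mathbb{N}$, let $j_m(z)\in\mathbb{N}_0$ be such that $z\in A_m(z):=(2^{-m}j_m(z),2^{-m}(j_m(z)+1)]$, and $A_m(\mathbf{z})=\times_{i=1}^n A_m(z_i)$. Let $K^{(m)}_{t_i,z_i}=\{(x,y,f)\in S: y f(t_i-x)\in A_m(z_i)\}$, $K^{(m)}_{\mathbf{t},\mathbf{z}}=\{(x,y,f)\in S: y f(t_i-x)\le 2^{-m}(j_m(z_i)+1)\text{ for all }i,\ y f(t_i-x)\in A_m(z_i)\text{ for some }i\}$, $\overline{K_{\mathbf{t},\mathbf{z}}}^{(m)}=\{(x,y,f)\in S: y f(t_i-x)>2^{-m}(j_m(z_i)+1)\text{ for some }i\}$, $I_A^{(m)}(\mathbf{z})=K^{(m)}_{\mathbf{t},\mathbf{z}}\cap\big(\bigcap_{i\in A}K^{(m)}_{t_i,z_i}\setminus\bigcup_{j\in A^c}K^{(m)}_{t_j,z_j}\big)$. Scenarios: $N_1=\{(n_A)_{A\in\mathcal{A}}\in\mathbb{N}_0^{2^n-1}:\sum_{A\ni i}n_A\ge1,\ i=1,\ldots,n\}$ and, for $\mathbf{n}=(n_A)_{A\in\mathcal{A}}\in N_1$, $E_{\mathbf{n}}(\mathbf{z})=\{|\Pi\cap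 I_A(\mathbf{z})|=n_A,\ A\in\mathcal{A},\ |\Pi\cap\overline{K_{\mathbf{t},\mathbf{z}}}|=0\}$, $E^{(m)}_{\mathbf{n}}(\mathbf{z})=\{|\Pi\cap I^{(m)}_A(\mathbf{z})|=n_A,\ A\in\mathcal{A},\ |\Pi\cap\overline{K_{\mathbf{t},\mathbf{z}}}^{(m)}|=0\}$.
   Formalization: In part 2 the Borel sets B_j are taken from a countable family fixed before z, so the exceptional null set may depend on that family; with one null set for all Borel sets the claim fails (n = k = l = r_1 = 1, B_1 = K_{t,z}: left side 1, right side 0). *)

theory Defs
  imports "HOL-Probability.Probability"
begin

type_synonym 'a storm = "'a \<times> real \<times> ('a \<Rightarrow> real)"

definition storm_space :: "('a \<Rightarrow> real) set \<Rightarrow> 'a storm set" where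
  "storm_space G = UNIV \<times> {0<..} \<times> G"

text \<open>For countable, discrete \<open>G\<close> the \<sigma>-algebra of this product measure is the Borel
  \<sigma>-algebra of \<open>storm_space G\<close>. The argument \<open>PF\<close> is the law of the random function.\<close>

definition storm_intensity ::
    "('a::euclidean_space \<Rightarrow> real) measure \<Rightarrow> 'a storm measure" where
  "storm_intensity PF =
     lborel \<Otimes>\<^sub>M (density (restrict_space lborel {0<..}) (\<lambda>u. ennreal (1 / u\<^sup>2)) \<Otimes>\<^sub>M PF)"

text \<open>Counting with \<open>card\<close> would give infinite sets the value 0; here they get \<open>\<infinity>\<close>.\<close>

abbreviation num_points :: "'b set \<Rightarrow> ennreal" where
  "num_points X \<equiv> emeasure (count_space UNIV) X"

text \<open>Since \<open>G\<close> is discrete, every compact subset of \<open>storm_space G\<close> lies in a finite union of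
  boxes \<open>K \<times> J \<times> {f}\<close> as below.\<close>

definition locally_finite_storms ::
    "('a::euclidean_space \<Rightarrow> real) set \<Rightarrow> 'a storm set \<Rightarrow> bool" where
  "locally_finite_storms G X \<longleftrightarrow>
     X \<subseteq> storm_space G \<and>
     (\<forall>K J f. compact K \<and> compact J \<and> J \<subseteq> {0<..} \<and> f \<in> G \<longrightarrow> finite (X \<inter> K \<times> J \<times> {f}))"

text \<open>The process is represented by its random set of points; this loses nothing as the intensity
  is diffuse, so that the process is simple. The Poisson probabilities are written out since
  \<open>poisson_pmf\<close> excludes the rate 0.\<close>

definition poisson_point_process ::
    "'w measure \<Rightarrow> ('a::euclidean_space \<Rightarrow> real) set \<Rightarrow> 'a storm measure \<Rightarrow>
      ('w \<Rightarrow> 'a storm set) \<Rightarrow> bool" where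
  "poisson_point_process M G L \<Phi> \<longleftrightarrow>
     (\<forall>\<omega>\<in>space M. locally_finite_storms G (\<Phi> \<omega>)) \<and>
     (\<forall>B\<in>sets L. (\<lambda>\<omega>. num_points (\<Phi> \<omega> \<inter> B)) \<in> borel_measurable M) \<and>
     (\<forall>B\<in>sets L. emeasure L B < \<infinity> \<longrightarrow>
        (\<forall>k::nat. \<P>(\<omega> in M. num_points (\<Phi> \<omega> \<inter> B) = of_nat k)
                  = measure L B ^ k / fact k * exp (- measure L B))) \<and>
     (\<forall>B\<in>sets L. emeasure L B = \<infinity> \<longrightarrow> (AE \<omega> in M. num_points (\<Phi> \<omega> \<inter> B) = \<infinity>)) \<and>
     (\<forall>(N::nat) B. (\<forall>i<N. B i \<in> sets L) \<and> disjoint_family_on B {..<N} \<longrightarrow>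
        prob_space.indep_vars M (\<lambda>_. borel) (\<lambda>i \<omega>. num_points (\<Phi> \<omega> \<inter> B i)) {..<N})"

definition process_algebra ::
    "'w measure \<Rightarrow> 'a storm measure \<Rightarrow> ('w \<Rightarrow> 'a storm set) \<Rightarrow> 'w measure" where
  "process_algebra M L \<Phi> =
     sigma (space M)
       {(\<lambda>\<omega>. num_points (\<Phi> \<omega> \<inter> B)) -` U \<inter> space M | B U. B \<in> sets L \<and> U \<in> sets borel}"

definition regular_cond_prob ::
    "'w measure \<Rightarrow> 'w measure \<Rightarrow> 'b measure \<Rightarrow> ('w \<Rightarrow> 'b) \<Rightarrow> ('b \<Rightarrow> 'w measure) \<Rightarrow> bool" where
  "regular_cond_prob M N Y X \<kappa> \<longleftrightarrow>
     subalgebra M N \<and> X \<in> M \<rightarrow>\<^sub>M Y \<and> \<kappa> \<in> Y \<rightarrow>\<^sub>M prob_algebra N \<and>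
     (\<forall>E\<in>sets N. \<forall>B\<in>sets Y.
        emeasure M (E \<inter> (X -` B \<inter> space M)) = (\<integral>\<^sup>+z\<in>B. emeasure (\<kappa> z) E \<partial>distr M Y X))"

text \<open>The real supremum is unspecified when the set of values is unbounded or empty; for the
  processes considered here this has probability 0, and almost surely the supremum is a maximum.\<close>

definition max_field :: "'a::euclidean_space storm set \<Rightarrow> 'a \<Rightarrow> real" where
  "max_field X x = (SUP (s, u, f)\<in>X. u * f (x - s))"

definition max_vec ::
    "('n::finite \<Rightarrow> 'a::euclidean_space) \<Rightarrow> 'a storm set \<Rightarrow> real ^ 'n" where
  "max_vec t X = (\<chi> i. max_field X (t i))"

text \<open>In \<open>ennreal\<close>, dividing a positive number by 0 gives \<open>\<infinity>\<close>.\<close>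

definition K_set ::
    "('a::euclidean_space \<Rightarrow> real) set \<Rightarrow> ('n::finite \<Rightarrow> 'a) \<Rightarrow> real ^ 'n \<Rightarrow> 'a storm set" where
  "K_set G t z = {(x, y, f) \<in> storm_space G.
     ennreal y = (MIN i. ennreal (z $ i) / ennreal (f (t i - x)))}"

definition K_bar ::
    "('a::euclidean_space \<Rightarrow> real) set \<Rightarrow> ('n::finite \<Rightarrow> 'a) \<Rightarrow> real ^ 'n \<Rightarrow> 'a storm set" where
  "K_bar G t z = {(x, y, f) \<in> storm_space G. \<exists>j. y * f (t j - x) > z $ j}"

definition Pi1 ::
    "('a::euclidean_space \<Rightarrow> real) set \<Rightarrow> ('n::finite \<Rightarrow> 'a) \<Rightarrow> 'a storm set \<Rightarrow> 'a storm set" where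
  "Pi1 G t X = X \<inter> K_bar G t (max_vec t X)"

definition Pi2 ::
    "('a::euclidean_space \<Rightarrow> real) set \<Rightarrow> ('n::finite \<Rightarrow> 'a) \<Rightarrow> 'a storm set \<Rightarrow> 'a storm set" where
  "Pi2 G t X = X \<inter> K_set G t (max_vec t X)"

definition Pi3 ::
    "('a::euclidean_space \<Rightarrow> real) set \<Rightarrow> ('n::finite \<Rightarrow> 'a) \<Rightarrow> 'a storm set \<Rightarrow> 'a storm set" where
  "Pi3 G t X = X - (Pi1 G t X \<union> Pi2 G t X)"

definition I_set ::
    "('a::euclidean_space \<Rightarrow> real) set \<Rightarrow> ('n::finite \<Rightarrow> 'a) \<Rightarrow> 'n set \<Rightarrow> real ^ 'n
      \<Rightarrow> 'a storm set" where
  "I_set G t A z = {(x, y, f) \<in> storm_space G.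
     (\<forall>i\<in>A. y * f (t i - x) = z $ i) \<and> (\<forall>j\<in>-A. y * f (t j - x) < z $ j)}"

definition cell_index :: "nat \<Rightarrow> real \<Rightarrow> nat" where
  "cell_index m z = (THE j. z \<in> {real j / 2 ^ m <.. (real j + 1) / 2 ^ m})"

definition cell :: "nat \<Rightarrow> real \<Rightarrow> real set" where
  "cell m z = {real (cell_index m z) / 2 ^ m <.. (real (cell_index m z) + 1) / 2 ^ m}"

lemma cell_index_eq:
  assumes "z > 0"
  shows "cell_index m z = nat (\<lceil>2 ^ m * z\<rceil> - 1)"
  unfolding cell_index_def
proof (rule the_equality)
  have pos: "\<lceil>2 ^ m * z\<rceil> \<ge> 1"
    using assms by (simp add: one_le_ceiling)
  have "real (nat (\<lceil>2 ^ m * z\<rceil> - 1)) = of_int \<lceil>2 ^ m * z\<rceil> - 1"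
    using pos by simp
  moreover have "of_int \<lceil>2 ^ m * z\<rceil> - 1 < 2 ^ m * z" "2 ^ m * z \<le> of_int \<lceil>2 ^ m * z\<rceil>"
    by linarith+
  ultimately show "z \<in> {real (nat (\<lceil>2 ^ m * z\<rceil> - 1)) / 2 ^ m <..
      (real (nat (\<lceil>2 ^ m * z\<rceil> - 1)) + 1) / 2 ^ m}"
    by (simp add: field_simps)
next
  fix j :: nat
  assume "z \<in> {real j / 2 ^ m <.. (real j + 1) / 2 ^ m}"
  then have "real j < 2 ^ m * z" "2 ^ m * z \<le> real j + 1"
    by (simp_all add: field_simps)
  then have "\<lceil>2 ^ m * z\<rceil> = int j + 1"
    by (intro ceiling_unique) auto
  then show "j = nat (\<lceil>2 ^ m * z\<rceil> - 1)"
    by simp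
qed

lemma mem_cell:
  assumes "z > 0"
  shows "z \<in> cell m z"
proof -
  have "real (nat (\<lceil>2 ^ m * z\<rceil> - 1)) = of_int \<lceil>2 ^ m * z\<rceil> - 1"
    using assms by (simp add: one_le_ceiling)
  moreover have "of_int \<lceil>2 ^ m * z\<rceil> - 1 < 2 ^ m * z" "2 ^ m * z \<le> of_int \<lceil>2 ^ m * z\<rceil>"
    by linarith+
  ultimately show ?thesis
    by (simp add: cell_def cell_index_eq[OF assms] field_simps)
qed

definition cell_vec :: "nat \<Rightarrow> real ^ 'n::finite \<Rightarrow> (real ^ 'n) set" where
  "cell_vec m z = {w. \<forall>i. w $ i \<in> cell m (z $ i)}"

definition K_blur1 ::
    "('a::euclidean_space \<Rightarrow> real) set \<Rightarrow> nat \<Rightarrow> 'a \<Rightarrow> real \<Rightarrow> 'a storm set" where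
  "K_blur1 G m s a = {(x, y, f) \<in> storm_space G. y * f (s - x) \<in> cell m a}"

definition K_blur ::
    "('a::euclidean_space \<Rightarrow> real) set \<Rightarrow> nat \<Rightarrow> ('n::finite \<Rightarrow> 'a) \<Rightarrow> real ^ 'n
      \<Rightarrow> 'a storm set" where
  "K_blur G m t z = {(x, y, f) \<in> storm_space G.
     (\<forall>i. y * f (t i - x) \<le> (real (cell_index m (z $ i)) + 1) / 2 ^ m) \<and>
     (\<exists>i. y * f (t i - x) \<in> cell m (z $ i))}"

definition K_bar_blur ::
    "('a::euclidean_space \<Rightarrow> real) set \<Rightarrow> nat \<Rightarrow> ('n::finite \<Rightarrow> 'a) \<Rightarrow> real ^ 'n
      \<Rightarrow> 'a storm set" where
  "K_bar_blur G m t z = {(x, y, f) \<in> storm_space G.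
     \<exists>i. y * f (t i - x) > (real (cell_index m (z $ i)) + 1) / 2 ^ m}"

definition I_blur ::
    "('a::euclidean_space \<Rightarrow> real) set \<Rightarrow> nat \<Rightarrow> ('n::finite \<Rightarrow> 'a) \<Rightarrow> 'n set \<Rightarrow> real ^ 'n
      \<Rightarrow> 'a storm set" where
  "I_blur G m t A z = K_blur G m t z \<inter>
     ((\<Inter>i\<in>A. K_blur1 G m (t i) (z $ i)) - (\<Union>j\<in>-A. K_blur1 G m (t j) (z $ j)))"

text \<open>Scenarios are indexed by nonempty sets only: the value at the empty set is never used.\<close>

definition scenarios :: "('n::finite set \<Rightarrow> nat) set" where
  "scenarios = {c. \<forall>i. (\<Sum>A | A \<noteq> {} \<and> i \<in> A. c A) \<ge> 1}"

definition scenario_event ::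
    "('a::euclidean_space \<Rightarrow> real) set \<Rightarrow> ('n::finite \<Rightarrow> 'a) \<Rightarrow> ('n set \<Rightarrow> nat) \<Rightarrow> real ^ 'n
      \<Rightarrow> 'a storm set \<Rightarrow> bool" where
  "scenario_event G t c z X \<longleftrightarrow>
     (\<forall>A. A \<noteq> {} \<longrightarrow> num_points (X \<inter> I_set G t A z) = of_nat (c A)) \<and>
     num_points (X \<inter> K_bar G t z) = 0"

definition scenario_event_blur ::
    "('a::euclidean_space \<Rightarrow> real) set \<Rightarrow> nat \<Rightarrow> ('n::finite \<Rightarrow> 'a) \<Rightarrow> ('n set \<Rightarrow> nat) \<Rightarrow> real ^ 'n
      \<Rightarrow> 'a storm set \<Rightarrow> bool" where
  "scenario_event_blur G m t c z X \<longleftrightarrow>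
     (\<forall>A. A \<noteq> {} \<longrightarrow> num_points (X \<inter> I_blur G m t A z) = of_nat (c A)) \<and>
     num_points (X \<inter> K_bar_blur G m t z) = 0"

end

theory Submission
  imports Defs
begin

text \<open>
  On the event that \<open>Z \<omega>\<close> lies in the dyadic cell of a positive point \<open>z\<close>, the sets blurred at level
  \<open>m\<close> around \<open>z\<close> are the same as those blurred around \<open>Z \<omega>\<close>. The probabilities of the blurred events
  are therefore conditional probabilities, given the cell of \<open>Z\<close>, of events \<open>E\<^sub>m\<close> that no longer
  mention \<open>z\<close>. Two things remain: \<open>E\<^sub>m\<close> has to agree with the exact event \<open>E\<close> for all large \<open>m\<close>,
  almost surely, and conditioning on ever smaller cells has to turn into the kernel \<open>\<kappa>\<close> in the limit.

  The first is a matter of finiteness (\<open>blurred_sets_eventually_exact\<close>). The storms whose value at a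
  site exceeds \<open>a > 0\<close> have intensity \<open>1 / a\<close>, so almost surely there are finitely many of them. As
  \<open>Z \<omega>\<close> is the supremum, no storm exceeds it, and if \<open>Z \<omega> > 0\<close> then the finitely many storms whose
  values come close to a component of \<open>Z \<omega>\<close> either attain it or stay a positive distance below it.
  A fine enough cell sees only the former.

  The second is a differentiation theorem for measures along a refining sequence of countable
  partitions (\<open>AE_level_set_ratio_tendsto\<close>). It follows from outer regularity alone: among the cells
  contained in an open set that barely exceeds \<open>{h < a}\<close>, the maximal ones on which the average of \<open>h\<close>
  is greater than \<open>b > a\<close> are disjoint, and comparing the integral of \<open>h\<close> over their union with
  \<open>a\<close> times its measure shows that this union is small. Both combine as in Hunt's lemma: the error events
  \<open>D\<^sub>k\<close>, that \<open>E\<^sub>m\<close> and \<open>E\<close> differ for some \<open>m \<ge> k\<close>, decrease to a set that is null on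
  \<open>Z > 0\<close>, so \<open>\<kappa> z D\<^sub>k\<close> tends to 0 for almost every \<open>z > 0\<close>. Given a cell of level \<open>m \<ge> k\<close>, the
  probabilities of \<open>E\<^sub>m\<close> and \<open>E\<close> differ by at most that of \<open>D\<^sub>k\<close>, which converges to
  \<open>\<kappa> z D\<^sub>k\<close> as \<open>m \<rightarrow> \<infinity>\<close>.

  All these events have to lie in the \<sigma>-algebra of the process itself, as the kernel lives there.
  Hence counts of points in random sets and the field \<open>Z\<close>, with its default values, are shown to be
  measurable without discarding null sets (\<open>borel_measurable_num_points_random_set\<close>,
  \<open>borel_measurable_max_field\<close>).
\<close>

section \<open>Differentiation along refining partitions\<close>

definition level_set :: "('a \<Rightarrow> 'c) \<Rightarrow> 'a \<Rightarrow> 'a set" where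
  "level_set q x = {y. q y = q x}"

text \<open>The partition at level \<open>m\<close> is encoded by a map \<open>q m\<close> into a countable type, whose level sets are
  the cells.\<close>

locale refining_partitions =
  fixes q :: "nat \<Rightarrow> 'a::{second_countable_topology, complete_space} \<Rightarrow> 'c::countable"
  assumes meas: "\<And>m x. level_set (q m) x \<in> sets borel"
    and refine: "\<And>m x y. q (Suc m) x = q (Suc m) y \<Longrightarrow> q m x = q m y"
    and shrink: "\<And>x U. open U \<Longrightarrow> x \<in> U \<Longrightarrow> \<forall>\<^sub>F m in sequentially. level_set (q m) x \<subseteq> U"
begin

text \<open>Two cells that meet are nested, so the good cells that lie in no coarser good cell are disjoint and
  cover everything that the good cells cover. The inequality on each of them thus adds up, for any two
  measures. This replaces a maximal inequality.\<close>

lemma measure_maximal_level_sets_ge: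
  assumes fin: "finite_measure \<nu>" "finite_measure \<eta>"
    and sets: "sets \<nu> = sets borel" "sets \<eta> = sets borel"
    and b: "0 \<le> b"
    and good: "\<And>m x. good m x \<Longrightarrow> b * measure \<nu> (level_set (q m) x) \<le> measure \<eta> (level_set (q m) x)"
    and good_cong: "\<And>m x y. q m x = q m y \<Longrightarrow> good m x \<longleftrightarrow> good m y"
  shows "{x. \<exists>m. good m x} \<in> sets borel"
    and "b * measure \<nu> {x. \<exists>m. good m x} \<le> measure \<eta> {x. \<exists>m. good m x}"
proof -
  \<comment> \<open>a maximal good cell, given by its level and its value of \<open>q\<close>\<close>
  define I where "I = {(m, c). \<exists>x. c = q m x \<and> good m x \<and> (\<forall>k<m. \<not> good k x)}"
  define C where "C = (\<lambda>(m, c). {x. q m x = c})"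
  have refine': "q k x = q k y" if "q m x = q m y" "k \<le> m" for k m x y
    using that(2,1) by (induction rule: inc_induct) (auto dest: refine)
  have C_I: "\<exists>m x. i = (m, q m x) \<and> C i = level_set (q m) x \<and> good m x \<and> (\<forall>k<m. \<not> good k x)" if "i \<in> I" for i
    using that by (auto simp: I_def C_def level_set_def)
  have union: "{x. \<exists>m. good m x} = (\<Union>i\<in>I. C i)"
  proof (intro equalityI subsetI)
    fix x assume "x \<in> {x. \<exists>m. good m x}"
    then obtain m where "good m x" "\<forall>k<m. \<not> good k x"
      using exists_least_iff[of "\<lambda>m. good m x"] by blast
    then show "x \<in> (\<Union>i\<in>I. C i)"
      by (intro UN_I[of "(m, q m x)"]) (auto simp: I_def C_def)
  next
    fix x assume "x \<in> (\<Union>i\<in>I. C i)"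
    then obtain i where "i \<in> I" "x \<in> C i" by blast
    then obtain m y where "q m x = q m y" "good m y"
      using C_I[of i] by (auto simp: level_set_def)
    then show "x \<in> {x. \<exists>m. good m x}"
      using good_cong by blast
  qed
  have disj: "disjoint_family_on C I"
  proof (unfold disjoint_family_on_def, intro ballI impI, rule ccontr)
    fix i j assume ij: "i \<in> I" "j \<in> I" "i \<noteq> j" "C i \<inter> C j \<noteq> {}"
    obtain m x where i: "i = (m, q m x)" "C i = level_set (q m) x" "good m x" "\<forall>k<m. \<not> good k x"
      using C_I[OF ij(1)] by blast
    obtain l y where j: "j = (l, q l y)" "C j = level_set (q l) y" "good l y" "\<forall>k<l. \<not> good k y"
      using C_I[OF ij(2)] by blast
    obtain w where w: "q m w = q m x" "q l w = q l y"
      using ij(4) i j by (auto simp: level_set_def)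
    consider "m < l" | "l < m" | "m = l" by linarith
    then show False
    proof cases
      case 1
      then have "q m y = q m x"
        using refine'[OF w(2), of m] w(1) by simp
      then show False
        using 1 i(3) j(4) good_cong by blast
    next
      case 2
      then have "q l x = q l y"
        using refine'[OF w(1), of l] w(2) by simp
      then show False
        using 2 j(3) i(4) good_cong by blast
    next
      case 3
      then show False
        using w i(1) j(1) ij(3) by simp
    qed
  qed
  have I: "countable I"
    by (rule countable_subset[of _ UNIV]) auto
  have CS: "C i \<in> sets borel" if "i \<in> I" for i
    using C_I[OF that] meas by auto
  show "{x. \<exists>m. good m x} \<in> sets borel"
    unfolding union using I CS by (intro sets.countable_UN'') auto
  have "ennreal b * emeasure \<nu> (\<Union>i\<in>I. C i) = (\<integral>\<^sup>+i. ennreal b * emeasure \<nu> (C i) \<partial>count_space I)"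
    using CS by (subst emeasure_UN_countable[OF _ I disj]) (auto simp: sets nn_integral_cmult)
  also have "\<dots> \<le> (\<integral>\<^sup>+i. emeasure \<eta> (C i) \<partial>count_space I)"
  proof (intro nn_integral_mono)
    fix i assume "i \<in> space (count_space I)"
    then obtain m x where "C i = level_set (q m) x" "good m x"
      using C_I[of i] by auto
    then show "ennreal b * emeasure \<nu> (C i) \<le> emeasure \<eta> (C i)"
      using good[of m x] b
      by (simp add: finite_measure.emeasure_eq_measure[OF fin(1)] finite_measure.emeasure_eq_measure[OF fin(2)] flip: ennreal_mult')
  qed
  also have "\<dots> = emeasure \<eta> (\<Union>i\<in>I. C i)"
    using CS by (subst emeasure_UN_countable[OF _ I disj]) (auto simp: sets)
  finally show "b * measure \<nu> {x. \<exists>m. good m x} \<le> measure \<eta> {x. \<exists>m. good m x}"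
    unfolding union using b
    by (simp add: finite_measure.emeasure_eq_measure[OF fin(1)] finite_measure.emeasure_eq_measure[OF fin(2)] flip: ennreal_mult')
qed

text \<open>Since \<open>h < a\<close> on all but \<open>\<epsilon>\<close> of an open set around \<open>{h < a}\<close>, a union \<open>W\<close> of disjoint cells in it
  on which \<open>h\<close> averages to more than \<open>b\<close> has measure at most \<open>\<epsilon> / (b - a)\<close>. Every exceptional point lies in
  such a cell, because the cells shrink into the open set.\<close>

lemma AE_level_set_ratio_le:
  assumes fin: "finite_measure \<nu>" and sets: "sets \<nu> = sets borel"
    and h[measurable]: "h \<in> borel_measurable borel" and h01: "\<And>x. 0 \<le> h x" "\<And>x. h x \<le> 1"
    and ab: "0 \<le> a" "a < b"
  shows "AE x in \<nu>. h x < a \<longrightarrow> (\<forall>\<^sub>F m in sequentially.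
    measure (density \<nu> (\<lambda>x. ennreal (h x))) (level_set (q m) x) \<le> b * measure \<nu> (level_set (q m) x))"
proof -
  interpret finite_measure \<nu> by fact
  define \<eta> where "\<eta> = density \<nu> (\<lambda>x. ennreal (h x))"
  have [measurable_cong, simp]: "sets \<nu> = sets borel" "sets \<eta> = sets borel"
    by (simp_all add: sets \<eta>_def)
  have [simp]: "space \<nu> = UNIV" using sets_eq_imp_space_eq[OF sets] by simp
  have \<eta>_le: "emeasure \<eta> A \<le> emeasure \<nu> A" if [measurable]: "A \<in> sets borel" for A
  proof -
    have "emeasure \<eta> A = (\<integral>\<^sup>+x. ennreal (h x) * indicator A x \<partial>\<nu>)"
      unfolding \<eta>_def by (intro emeasure_density) auto
    also have "\<dots> \<le> (\<integral>\<^sup>+x. indicator A x \<partial>\<nu>)"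
      using h01 by (intro nn_integral_mono) (auto split: split_indicator)
    finally show ?thesis by simp
  qed
  have fin\<eta>: "finite_measure \<eta>"
    using \<eta>_le[of UNIV] by (intro finite_measureI) (auto simp: \<eta>_def top_unique)
  interpret E: finite_measure \<eta> by fact
  define S where "S = {x. h x < a \<and> \<not> (\<forall>\<^sub>F m in sequentially. measure \<eta> (level_set (q m) x) \<le> b * measure \<nu> (level_set (q m) x))}"
  define A where "A = {x. h x < a}"
  have A[measurable]: "A \<in> sets borel" unfolding A_def by measurable
  have cover: "\<exists>W\<in>sets borel. S \<subseteq> W \<and> (b - a) * measure \<nu> W \<le> \<epsilon>" if "0 < \<epsilon>" for \<epsilon> :: real
  proof -
    have "emeasure \<nu> A < emeasure \<nu> A + ennreal \<epsilon>"
      using \<open>0 < \<epsilon>\<close> by (simp add: emeasure_eq_measure)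
    moreover have "emeasure \<nu> A = (INF U \<in> {U. A \<subseteq> U \<and> open U}. emeasure \<nu> U)"
      by (rule outer_regular) auto
    ultimately have "(INF U \<in> {U. A \<subseteq> U \<and> open U}. emeasure \<nu> U) < emeasure \<nu> A + ennreal \<epsilon>"
      by simp
    then obtain U where U: "A \<subseteq> U" "open U" "emeasure \<nu> U < emeasure \<nu> A + ennreal \<epsilon>"
      unfolding INF_less_iff by auto
    have [measurable]: "U \<in> sets borel" using U by auto
    define good where "good m x \<longleftrightarrow> level_set (q m) x \<subseteq> U \<and>
      b * measure \<nu> (level_set (q m) x) < measure \<eta> (level_set (q m) x)" for m x
    define W where "W = {x. \<exists>m. good m x}"
    have level_cong: "level_set (q m) x = level_set (q m) y" if "q m x = q m y" for m x y
      using that by (simp add: level_set_def)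
    have good_cong: "good m x \<longleftrightarrow> good m y" if "q m x = q m y" for m x y
      unfolding good_def level_cong[OF that] ..
    have good_ge: "b * measure \<nu> (level_set (q m) x) \<le> measure \<eta> (level_set (q m) x)" if "good m x" for m x
      using that by (simp add: good_def)
    have "0 \<le> b" using ab by simp
    note W = measure_maximal_level_sets_ge[where good = good and \<nu> = \<nu> and \<eta> = \<eta>,
        OF fin fin\<eta> _ _ this good_ge good_cong]
    have W1[measurable]: "W \<in> sets borel"
      unfolding W_def by (rule W(1)) simp_all
    have W2: "b * measure \<nu> W \<le> measure \<eta> W"
      unfolding W_def by (rule W(2)) simp_all
    have "W \<subseteq> U" by (auto simp: W_def good_def level_set_def)
    have "S \<subseteq> W"
    proof
      fix x assume "x \<in> S"
      then have x: "x \<in> U" and f: "\<exists>\<^sub>F m in sequentially. \<not> (measure \<eta> (level_set (q m) x) \<le> b * measure \<nu> (level_set (q m) x))"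
        using U by (auto simp: S_def A_def frequently_def)
      from frequently_eventually_conj[OF f shrink[OF U(2) x]]
      have "\<exists>m. good m x"
        by (auto dest!: frequently_ex simp: good_def not_le)
      then show "x \<in> W" by (simp add: W_def)
    qed
    have "emeasure \<eta> W = (\<integral>\<^sup>+x. ennreal (h x) * indicator W x \<partial>\<nu>)"
      unfolding \<eta>_def by (intro emeasure_density) auto
    also have "\<dots> \<le> (\<integral>\<^sup>+x. ennreal a * indicator W x + indicator (U - A) x \<partial>\<nu>)"
    proof (intro nn_integral_mono)
      fix x
      have "ennreal (h x) \<le> ennreal a" if "x \<in> A"
        using that by (intro ennreal_leI) (simp add: A_def)
      moreover have "ennreal (h x) \<le> 1"
        using h01 by simp
      ultimately show "ennreal (h x) * indicator W x \<le> ennreal a * indicator W x + indicator (U - A) x"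
        using \<open>W \<subseteq> U\<close> by (cases "x \<in> W"; cases "x \<in> A") (auto intro: add_increasing simp: subset_iff)
    qed
    also have "\<dots> = ennreal a * emeasure \<nu> W + emeasure \<nu> (U - A)"
      by (subst nn_integral_add) (auto simp: nn_integral_cmult)
    finally have "measure \<eta> W \<le> a * measure \<nu> W + measure \<nu> (U - A)"
      using ab by (simp add: emeasure_eq_measure E.emeasure_eq_measure flip: ennreal_mult' ennreal_plus)
    moreover have "measure \<nu> (U - A) \<le> \<epsilon>"
      using U \<open>0 < \<epsilon>\<close> by (subst finite_measure_Diff) (auto simp: emeasure_eq_measure ennreal_less_iff simp flip: ennreal_plus)
    ultimately have "(b - a) * measure \<nu> W \<le> \<epsilon>"
      using W2 by (simp add: algebra_simps)
    with \<open>S \<subseteq> W\<close> show ?thesis by auto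
  qed
  have "\<exists>W. \<forall>n::nat. W n \<in> sets borel \<and> S \<subseteq> W n \<and> (b - a) * measure \<nu> (W n) \<le> inverse (real (Suc n))"
    by (intro choice allI) (use cover in \<open>force simp: Bex_def\<close>)
  then obtain W where [measurable]: "\<And>n::nat. W n \<in> sets borel" and W: "\<And>n. S \<subseteq> W n"
      "\<And>n. (b - a) * measure \<nu> (W n) \<le> inverse (real (Suc n))"
    by blast
  have "(b - a) * measure \<nu> (\<Inter>n. W n) \<le> inverse (real (Suc n))" for n
    using ab by (intro order_trans[OF mult_left_mono[OF finite_measure_mono] W(2)[of n]]) auto
  then have "(b - a) * measure \<nu> (\<Inter>n. W n) \<le> 0"
    by (intro LIMSEQ_le_const[OF LIMSEQ_inverse_real_of_nat]) auto
  then have "measure \<nu> (\<Inter>n. W n) = 0"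
    using ab by (simp add: mult_le_0_iff measure_le_0_iff)
  then have "(\<Inter>n. W n) \<in> null_sets \<nu>"
    by (auto simp: null_sets_def emeasure_eq_measure)
  then show ?thesis
    by (rule AE_I') (use W in \<open>auto simp: S_def \<eta>_def\<close>)
qed

text \<open>Only upper bounds are available so far; the lower ones come from the upper ones for \<open>1 - h\<close>.\<close>

lemma AE_level_set_ratio_tendsto:
  assumes fin: "finite_measure \<nu>" and sets: "sets \<nu> = sets borel"
    and h[measurable]: "h \<in> borel_measurable borel" and h01: "\<And>x. 0 \<le> h x" "\<And>x. h x \<le> 1"
  shows "AE x in \<nu>. (\<lambda>m. measure (density \<nu> (\<lambda>x. ennreal (h x))) (level_set (q m) x) /
      measure \<nu> (level_set (q m) x)) \<longlonglongrightarrow> h x"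
proof -
  interpret finite_measure \<nu> by fact
  have [measurable_cong, simp]: "sets \<nu> = sets borel" by fact
  have [simp]: "space \<nu> = UNIV" using sets_eq_imp_space_eq[OF sets] by simp
  let ?c = "\<lambda>m x. level_set (q m) x"
  note [measurable] = meas
  define \<eta> \<eta>' where "\<eta> = density \<nu> (\<lambda>x. ennreal (h x))"
    and "\<eta>' = density \<nu> (\<lambda>x. ennreal (1 - h x))"
  have sum: "measure \<eta> A + measure \<eta>' A = measure \<nu> A" if [measurable]: "A \<in> sets borel" for A
  proof -
    have "emeasure \<eta> A + emeasure \<eta>' A = (\<integral>\<^sup>+x. ennreal (h x) * indicator A x + ennreal (1 - h x) * indicator A x \<partial>\<nu>)"
      unfolding \<eta>_def \<eta>'_def by (subst nn_integral_add) (auto simp: emeasure_density)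
    also have "\<dots> = (\<integral>\<^sup>+x. indicator A x \<partial>\<nu>)"
      using h01 by (intro nn_integral_cong) (auto split: split_indicator simp flip: ennreal_plus)
    finally have *: "emeasure \<eta> A + emeasure \<eta>' A = ennreal (measure \<nu> A)"
      by (simp add: emeasure_eq_measure)
    then have "emeasure \<eta> A \<noteq> top" "emeasure \<eta>' A \<noteq> top"
      by (auto simp: add_top)
    with * show ?thesis
      by (simp add: emeasure_eq_ennreal_measure flip: ennreal_plus)
  qed
  have pos: "AE x in \<nu>. \<forall>m. 0 < measure \<nu> (?c m x)"
  proof (rule AE_all_countable[THEN iffD2], rule allI)
    fix m
    define C where "C = {c. measure \<nu> {x. q m x = c} = 0 \<and> {x. q m x = c} \<in> sets borel}"
    have "(\<Union>c\<in>C. {x. q m x = c}) \<in> null_sets \<nu>"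
      by (intro null_sets_UN') (auto simp: C_def null_sets_def emeasure_eq_measure)
    then show "AE x in \<nu>. 0 < measure \<nu> (?c m x)"
    proof (rule AE_I')
      show "{x \<in> space \<nu>. \<not> 0 < measure \<nu> (?c m x)} \<subseteq> (\<Union>c\<in>C. {x. q m x = c})"
        using meas[of m] by (auto simp: C_def level_set_def not_less measure_le_0_iff)
    qed
  qed
  have up: "AE x in \<nu>. \<forall>a b :: rat. 0 \<le> a \<longrightarrow> a < b \<longrightarrow> g x < of_rat a \<longrightarrow> (\<forall>\<^sub>F m in sequentially.
      measure (density \<nu> (\<lambda>x. ennreal (g x))) (?c m x) \<le> of_rat b * measure \<nu> (?c m x))"
    if [measurable]: "g \<in> borel_measurable borel" and g: "\<And>x. 0 \<le> g x" "\<And>x. g x \<le> 1" for g :: "'a \<Rightarrow> real"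
    unfolding AE_all_countable
  proof (intro allI)
    fix a b :: rat
    show "AE x in \<nu>. 0 \<le> a \<longrightarrow> a < b \<longrightarrow> g x < of_rat a \<longrightarrow> (\<forall>\<^sub>F m in sequentially.
        measure (density \<nu> (\<lambda>x. ennreal (g x))) (?c m x) \<le> of_rat b * measure \<nu> (?c m x))"
      using AE_level_set_ratio_le[where h = g and a = "of_rat a" and b = "of_rat b", OF fin sets that]
      by (cases "0 \<le> a \<and> a < b") (auto simp: of_rat_less)
  qed
  have squeeze: "\<forall>\<^sub>F m in sequentially. n m / measure \<nu> (?c m x) < e"
    if "\<forall>a b :: rat. 0 \<le> a \<longrightarrow> a < b \<longrightarrow> y < of_rat a \<longrightarrow> (\<forall>\<^sub>F m in sequentially. n m \<le> of_rat b * measure \<nu> (?c m x))"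
      and "\<forall>m. 0 < measure \<nu> (?c m x)" "y < e" "0 \<le> y" for n x and y e :: real
  proof -
    obtain b where b: "y < of_rat b" "of_rat b < e"
      using of_rat_dense[OF \<open>y < e\<close>] by blast
    obtain a where a: "y < of_rat a" "of_rat a < (of_rat b :: real)"
      using of_rat_dense[OF b(1)] by blast
    have "(0::real) \<le> of_rat a" using a \<open>0 \<le> y\<close> by linarith
    then have "\<forall>\<^sub>F m in sequentially. n m \<le> of_rat b * measure \<nu> (?c m x)"
      using that(1) a by (auto simp: of_rat_less)
    then show ?thesis
    proof eventually_elim
      case (elim m)
      then have "n m / measure \<nu> (?c m x) \<le> of_rat b"
        using that(2) by (simp add: pos_divide_le_eq)
      then show ?case using b by simp
    qed
  qed
  have h': "(\<lambda>x. 1 - h x) \<in> borel_measurable borel" "0 \<le> 1 - h x" "1 - h x \<le> 1" for x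
    by (measurable, simp_all add: h01)
  from up[OF h h01, folded \<eta>_def] up[OF h', folded \<eta>'_def] pos
  show ?thesis
    unfolding \<eta>_def[symmetric]
  proof eventually_elim
    case (elim x)
    note 1 = elim(1) and 2 = elim(2) and pos = elim(3)
    show "(\<lambda>m. measure \<eta> (?c m x) / measure \<nu> (?c m x)) \<longlonglongrightarrow> h x"
    proof (rule order_tendstoI)
      fix e assume "h x < e"
      then show "\<forall>\<^sub>F m in sequentially. measure \<eta> (?c m x) / measure \<nu> (?c m x) < e"
        by (rule squeeze[OF 1 pos]) (simp add: h01)
    next
      fix e assume "e < h x"
      then have "\<forall>\<^sub>F m in sequentially. measure \<eta>' (?c m x) / measure \<nu> (?c m x) < 1 - e"
        by (intro squeeze[OF 2 pos]) (auto simp: h01)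
      then show "\<forall>\<^sub>F m in sequentially. e < measure \<eta> (?c m x) / measure \<nu> (?c m x)"
      proof eventually_elim
        case (elim m)
        have "measure \<eta>' (?c m x) / measure \<nu> (?c m x) = 1 - measure \<eta> (?c m x) / measure \<nu> (?c m x)"
          using sum[OF meas, of m x] pos[rule_format, of m] by (simp add: field_simps)
        with elim show ?case by simp
      qed
    qed
  qed
qed

end

section \<open>Conditioning on shrinking cells\<close>

context refining_partitions
begin

text \<open>The kernel disintegrates \<open>M\<close>, so \<open>E\<close> together with \<open>Z\<close> in a cell has the measure of that cell under the
  density \<open>z \<mapsto> \<kappa> z E\<close>.\<close>

lemma AE_cond_level_set_tendsto_kernel:
  assumes prob: "prob_space M" and kernel: "regular_cond_prob M N borel Z \<kappa>"
    and E: "E \<in> sets N"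
  shows "AE z in distr M borel Z.
    (\<lambda>m. measure M (E \<inter> (Z -` level_set (q m) z \<inter> space M)) / measure M (Z -` level_set (q m) z \<inter> space M))
      \<longlonglongrightarrow> measure (\<kappa> z) E"
proof -
  interpret prob_space M by fact
  have Z[measurable]: "Z \<in> borel_measurable M" and \<kappa>[measurable]: "\<kappa> \<in> borel \<rightarrow>\<^sub>M prob_algebra N"
    and dis: "\<And>B. B \<in> sets borel \<Longrightarrow>
        emeasure M (E \<inter> (Z -` B \<inter> space M)) = (\<integral>\<^sup>+z\<in>B. emeasure (\<kappa> z) E \<partial>distr M borel Z)"
    using kernel E unfolding regular_cond_prob_def by auto
  interpret D: prob_space "distr M borel Z" by (rule prob_space_distr) measurable
  have \<kappa>_prob: "prob_space (\<kappa> z)" for z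
    using measurable_space[OF \<kappa>, of z] by (simp add: space_prob_algebra)
  have h[measurable]: "(\<lambda>z. measure (\<kappa> z) E) \<in> borel_measurable borel"
    using E by measurable
  have "AE z in distr M borel Z. (\<lambda>m. measure (density (distr M borel Z) (\<lambda>z. ennreal (measure (\<kappa> z) E))) (level_set (q m) z) /
      measure (distr M borel Z) (level_set (q m) z)) \<longlonglongrightarrow> measure (\<kappa> z) E"
    by (rule AE_level_set_ratio_tendsto[OF D.finite_measure_axioms _ h])
      (auto intro: prob_space.prob_le_1[OF \<kappa>_prob])
  moreover have "measure (density (distr M borel Z) (\<lambda>z. ennreal (measure (\<kappa> z) E))) B = measure M (E \<inter> (Z -` B \<inter> space M))"
    if [measurable]: "B \<in> sets borel" for B
  proof -
    have "emeasure (\<kappa> z) E = ennreal (measure (\<kappa> z) E)" for z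
      using \<kappa>_prob by (simp add: finite_measure.emeasure_eq_measure prob_space.finite_measure)
    then have "emeasure (density (distr M borel Z) (\<lambda>z. ennreal (measure (\<kappa> z) E))) B = emeasure M (E \<inter> (Z -` B \<inter> space M))"
      by (subst emeasure_density) (simp_all add: dis)
    then show ?thesis
      by (simp only: measure_def)
  qed
  ultimately show ?thesis
    by (simp add: meas measure_distr)
qed

text \<open>A form of Hunt's lemma: in a limit of conditional probabilities the event may vary as well, as
  long as it converges almost surely. The set \<open>P\<close> restricts attention to those values of \<open>Z\<close> for which
  it does.\<close>

lemma AE_cond_level_set_tendsto_kernel_eventually:
  assumes prob: "prob_space M" and kernel: "regular_cond_prob M N borel Z \<kappa>"
    and E: "E \<in> sets N" and Em: "\<And>m. Em m \<in> sets N" and P: "P \<in> sets borel"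
    and ev: "AE \<omega> in M. Z \<omega> \<in> P \<longrightarrow> (\<forall>\<^sub>F m in sequentially. \<omega> \<in> Em m \<longleftrightarrow> \<omega> \<in> E)"
  shows "AE z in distr M borel Z. z \<in> P \<longrightarrow>
    (\<lambda>m. measure M (Em m \<inter> (Z -` level_set (q m) z \<inter> space M)) / measure M (Z -` level_set (q m) z \<inter> space M))
      \<longlonglongrightarrow> measure (\<kappa> z) E"
proof -
  interpret prob_space M by fact
  have Z[measurable]: "Z \<in> borel_measurable M" and \<kappa>: "\<kappa> \<in> borel \<rightarrow>\<^sub>M prob_algebra N"
    and sub: "subalgebra M N"
    and dis: "\<And>E B. E \<in> sets N \<Longrightarrow> B \<in> sets borel \<Longrightarrow>
        emeasure M (E \<inter> (Z -` B \<inter> space M)) = (\<integral>\<^sup>+z\<in>B. emeasure (\<kappa> z) E \<partial>distr M borel Z)"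
    using kernel unfolding regular_cond_prob_def by auto
  have NM: "A \<in> sets M" if "A \<in> sets N" for A
    using sub that by (auto simp: subalgebra_def)
  have \<kappa>_prob: "prob_space (\<kappa> z)" and \<kappa>_sets: "sets (\<kappa> z) = sets N" for z
    using measurable_space[OF \<kappa>, of z] by (simp_all add: space_prob_algebra)
  \<comment> \<open>the events converge outside the intersection of the error sets \<open>D k\<close>\<close>
  define D where "D k = (\<Union>m\<in>{k..}. (Em m - E) \<union> (E - Em m))" for k
  have D_N: "D k \<in> sets N" for k
    unfolding D_def using E Em by (intro sets.countable_UN'') auto
  have D_decseq: "decseq D"
    by (force simp: D_def decseq_def)
  have D_Inter: "(\<Inter>k. D k) \<in> sets N"
    using D_N by auto
  have "emeasure M ((\<Inter>k. D k) \<inter> (Z -` P \<inter> space M)) = 0"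
  proof (rule emeasure_eq_0_AE[of "\<lambda>\<omega>. \<omega> \<in> (\<Inter>k. D k) \<and> Z \<omega> \<in> P" M, THEN back_subst[where P = "\<lambda>A. emeasure M A = 0"]])
    show "AE \<omega> in M. \<not> (\<omega> \<in> (\<Inter>k. D k) \<and> Z \<omega> \<in> P)"
      using ev by eventually_elim (auto simp: D_def eventually_sequentially; blast)
    show "{\<omega> \<in> space M. \<omega> \<in> (\<Inter>k. D k) \<and> Z \<omega> \<in> P} = (\<Inter>k. D k) \<inter> (Z -` P \<inter> space M)"
      by auto
  qed
  then have "(\<integral>\<^sup>+z\<in>P. emeasure (\<kappa> z) (\<Inter>k. D k) \<partial>distr M borel Z) = 0"
    by (simp add: dis[OF D_Inter P])
  moreover have [measurable]: "(\<lambda>z. emeasure (\<kappa> z) (\<Inter>k. D k)) \<in> borel_measurable borel"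
    using measurable_compose[OF measurable_prob_algebraD[OF \<kappa>] measurable_emeasure_subprob_algebra[OF D_Inter]] .
  ultimately have null: "AE z in distr M borel Z. z \<in> P \<longrightarrow> emeasure (\<kappa> z) (\<Inter>k. D k) = 0"
    using P by (subst (asm) nn_integral_0_iff_AE) (auto elim!: eventually_mono split: split_indicator_asm)
  note lim = AE_cond_level_set_tendsto_kernel[OF prob kernel]
  have "AE z in distr M borel Z. \<forall>k.
     (\<lambda>m. measure M (D k \<inter> (Z -` level_set (q m) z \<inter> space M)) / measure M (Z -` level_set (q m) z \<inter> space M))
      \<longlonglongrightarrow> measure (\<kappa> z) (D k)"
    unfolding AE_all_countable by (intro allI lim D_N)
  with null lim[OF E] show ?thesis
  proof eventually_elim
    case (elim z)
    let ?C = "\<lambda>m. Z -` level_set (q m) z \<inter> space M"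
    let ?P = "\<lambda>A m. measure M (A \<inter> ?C m) / measure M (?C m)"
    interpret K: prob_space "\<kappa> z" by (rule \<kappa>_prob)
    have C[measurable]: "?C m \<in> sets M" for m
      using meas[of m z] by measurable
    show ?case
    proof
      assume "z \<in> P"
      with elim have 0: "measure (\<kappa> z) (\<Inter>k. D k) = 0"
        by (simp add: measure_def)
      have D_lim: "(\<lambda>k. measure (\<kappa> z) (D k)) \<longlonglongrightarrow> 0"
        using K.finite_Lim_measure_decseq[OF _ D_decseq] D_N \<kappa>_sets 0 by auto
      have le: "\<bar>?P (Em m) m - ?P E m\<bar> \<le> ?P (D k) m" if "k \<le> m" for k m
      proof -
        have [measurable]: "E \<in> sets M" "Em m \<in> sets M" "D k \<in> sets M"
          using E Em D_N NM by auto
        have "Em m \<subseteq> E \<union> D k" "E \<subseteq> Em m \<union> D k"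
          using that by (auto simp: D_def)
        then have "Em m \<inter> ?C m \<subseteq> (E \<inter> ?C m) \<union> (D k \<inter> ?C m)" "E \<inter> ?C m \<subseteq> (Em m \<inter> ?C m) \<union> (D k \<inter> ?C m)"
          by auto
        note sub = this
        have "measure M (Em m \<inter> ?C m) \<le> measure M (E \<inter> ?C m) + measure M (D k \<inter> ?C m)"
          by (rule order_trans[OF finite_measure_mono[OF sub(1)] measure_Un_le]) measurable
        moreover have "measure M (E \<inter> ?C m) \<le> measure M (Em m \<inter> ?C m) + measure M (D k \<inter> ?C m)"
          by (rule order_trans[OF finite_measure_mono[OF sub(2)] measure_Un_le]) measurable
        ultimately have "\<bar>measure M (Em m \<inter> ?C m) - measure M (E \<inter> ?C m)\<bar> \<le> measure M (D k \<inter> ?C m)"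
          by linarith
        from divide_right_mono[OF this, of "measure M (?C m)"] show ?thesis
          unfolding diff_divide_distrib[symmetric] abs_divide by simp
      qed
      have "(\<lambda>m. ?P (Em m) m - ?P E m) \<longlonglongrightarrow> 0"
      proof (rule LIMSEQ_I)
        fix e :: real assume "0 < e"
        then obtain k where k: "measure (\<kappa> z) (D k) < e"
          using order_tendstoD(2)[OF D_lim] by (auto simp: eventually_sequentially)
        obtain m0 where m0: "\<And>m. m0 \<le> m \<Longrightarrow> ?P (D k) m < e"
          using order_tendstoD(2)[OF elim(3)[rule_format] k] by (auto simp: eventually_sequentially)
        show "\<exists>no. \<forall>m\<ge>no. norm (?P (Em m) m - ?P E m - 0) < e"
          using le_less_trans[OF le m0] by (intro exI[of _ "max k m0"]) simp
      qed
      from tendsto_add[OF this elim(2)] show "(\<lambda>m. ?P (Em m) m) \<longlonglongrightarrow> measure (\<kappa> z) E"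
        by simp
    qed
  qed
qed

end

text \<open>Rounding up matches cells that are open on the left. It makes sense for all real vectors,
  whereas \<^const>\<open>cell_vec\<close> is only meaningful at positive ones; there the two agree
  (\<open>cell_vec_eq_level_set\<close>).\<close>

definition dyadic_index :: "nat \<Rightarrow> real ^ 'n::finite \<Rightarrow> 'n \<Rightarrow> int" where
  "dyadic_index m z i = \<lceil>2 ^ m * z $ i\<rceil>"

lemma level_set_dyadic_index_borel: "level_set (dyadic_index m) z \<in> sets borel"
proof -
  have "level_set (dyadic_index m) z = {w. \<forall>i. \<lceil>2 ^ m * w $ i\<rceil> = \<lceil>2 ^ m * z $ i\<rceil>}"
    by (auto simp: level_set_def dyadic_index_def fun_eq_iff)
  also have "\<dots> \<in> sets borel" by measurable
  finally show ?thesis .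
qed

lemma dyadic_index_refine:
  assumes "dyadic_index (Suc m) x = dyadic_index (Suc m) y"
  shows "dyadic_index m x = dyadic_index m y"
proof
  fix i
  have half: "\<lceil>a\<rceil> \<le> k \<longleftrightarrow> \<lceil>2 * a\<rceil> \<le> 2 * k" for a :: real and k
    by (simp add: ceiling_le_iff)
  have "\<lceil>2 * (2 ^ m * x $ i)\<rceil> = \<lceil>2 * (2 ^ m * y $ i)\<rceil>"
    using fun_cong[OF assms, of i] by (simp add: dyadic_index_def mult.assoc)
  then show "dyadic_index m x i = dyadic_index m y i"
    unfolding dyadic_index_def by (metis half order_refl antisym)
qed

lemma level_set_dyadic_index_shrink:
  assumes "open U" "x \<in> U"
  shows "\<forall>\<^sub>F m in sequentially. level_set (dyadic_index m) (x :: real ^ 'n::finite) \<subseteq> U"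
proof -
  obtain e where e: "0 < e" "ball x e \<subseteq> U"
    using assms open_contains_ball by blast
  have "(\<lambda>m. real CARD('n) * (1 / 2) ^ m) \<longlonglongrightarrow> real CARD('n) * 0"
    by (intro tendsto_intros LIMSEQ_power_zero) auto
  from order_tendstoD(2)[OF this, of e] e
  have "\<forall>\<^sub>F m in sequentially. real CARD('n) * (1 / 2) ^ m < e"
    by simp
  then show ?thesis
  proof eventually_elim
    case (elim m)
    have "dist x y < e" if "dyadic_index m y = dyadic_index m x" for y
    proof -
      have "\<bar>(x - y) $ i\<bar> \<le> (1 / 2) ^ m" for i
      proof -
        have "\<lceil>2 ^ m * x $ i\<rceil> = \<lceil>2 ^ m * y $ i\<rceil>"
          using fun_cong[OF that, of i] by (simp add: dyadic_index_def)
        then have "\<bar>2 ^ m * x $ i - 2 ^ m * y $ i\<bar> \<le> 1"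
          by linarith
        then have "2 ^ m * \<bar>x $ i - y $ i\<bar> \<le> 1"
          by (simp add: abs_mult flip: right_diff_distrib)
        then show ?thesis
          by (simp add: field_simps)
      qed
      then have "norm (x - y) \<le> (\<Sum>i\<in>(UNIV :: 'n set). (1 / 2) ^ m)"
        by (intro order_trans[OF norm_le_l1_cart] sum_mono)
      with elim show ?thesis
        by (simp add: dist_norm)
    qed
    then show ?case
      using e(2) by (auto simp: level_set_def)
  qed
qed

interpretation dyadic: refining_partitions "dyadic_index :: nat \<Rightarrow> real ^ 'n::finite \<Rightarrow> 'n \<Rightarrow> int"
  by unfold_locales
    (fact level_set_dyadic_index_borel dyadic_index_refine level_set_dyadic_index_shrink)+

lemma cell_eq_ceiling: "0 < z \<Longrightarrow> cell m z = {w. \<lceil>2 ^ m * w\<rceil> = \<lceil>2 ^ m * z\<rceil>}"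
proof -
  assume z: "0 < z"
  have "real (nat (\<lceil>2 ^ m * z\<rceil> - 1)) = of_int \<lceil>2 ^ m * z\<rceil> - 1"
    using z by (simp add: one_le_ceiling)
  then have "w \<in> cell m z \<longleftrightarrow> of_int \<lceil>2 ^ m * z\<rceil> - 1 < 2 ^ m * w \<and> 2 ^ m * w \<le> of_int \<lceil>2 ^ m * z\<rceil>" for w
    unfolding cell_def cell_index_eq[OF z] by (auto simp: divide_less_eq le_divide_eq mult.commute)
  then show ?thesis
    by (auto simp: ceiling_eq_iff)
qed

lemma cell_vec_eq_level_set:
  "(\<And>i. 0 < z $ i) \<Longrightarrow> cell_vec m z = level_set (dyadic_index m) z"
  by (auto simp: cell_vec_def level_set_def dyadic_index_def cell_eq_ceiling fun_eq_iff)

section \<open>Measurability of counts in random sets\<close>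

text \<open>On each \<open>W k\<close> the counts are finite, hence closed under proper differences, and a Dynkin argument
  starting from rectangles applies; then \<open>k\<close> tends to infinity.\<close>

lemma borel_measurable_num_points_section:
  fixes \<Phi> :: "'w \<Rightarrow> 'b set" and W :: "nat \<Rightarrow> 'b set"
  assumes count: "\<And>B. B \<in> sets L \<Longrightarrow> (\<lambda>\<omega>. num_points (\<Phi> \<omega> \<inter> B)) \<in> borel_measurable N"
    and sub: "\<And>\<omega>. \<omega> \<in> space N \<Longrightarrow> \<Phi> \<omega> \<subseteq> space L"
    and W: "\<And>k. W k \<in> sets L" "incseq W" "(\<Union>k. W k) = space L"
    and fin: "\<And>\<omega> k. \<omega> \<in> space N \<Longrightarrow> finite (\<Phi> \<omega> \<inter> W k)"
    and Q: "Q \<in> sets (N \<Otimes>\<^sub>M L)"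
  shows "(\<lambda>\<omega>. num_points (\<Phi> \<omega> \<inter> Pair \<omega> -` Q)) \<in> borel_measurable N"
proof -
  have box: "(\<lambda>\<omega>. num_points (\<Phi> \<omega> \<inter> W k \<inter> Pair \<omega> -` Q)) \<in> borel_measurable N" for k
    using Int_stable_pair_measure_generator pair_measure_closed Q
    unfolding sets_pair_measure
  proof (induct rule: sigma_sets_induct_disjoint)
    case (basic A)
    then obtain a b where A: "A = a \<times> b" "a \<in> sets N" "b \<in> sets L" by auto
    have "num_points (\<Phi> \<omega> \<inter> W k \<inter> Pair \<omega> -` A) = num_points (\<Phi> \<omega> \<inter> (W k \<inter> b)) * indicator a \<omega>" for \<omega>
      by (auto simp: A Int_assoc split: split_indicator)
    then show ?case
      using A count[of "W k \<inter> b"] W by simp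
  next
    case (compl A)
    then have "num_points (\<Phi> \<omega> \<inter> W k \<inter> Pair \<omega> -` (space N \<times> space L - A)) =
        num_points (\<Phi> \<omega> \<inter> W k) - num_points (\<Phi> \<omega> \<inter> W k \<inter> Pair \<omega> -` A)" if "\<omega> \<in> space N" for \<omega>
    proof -
      have "\<Phi> \<omega> \<inter> W k \<inter> Pair \<omega> -` (space N \<times> space L - A) = \<Phi> \<omega> \<inter> W k - \<Phi> \<omega> \<inter> W k \<inter> Pair \<omega> -` A"
        using sub that by auto
      then show ?thesis
        using fin[OF that, of k] by (simp only:) (rule emeasure_Diff; auto)
    qed
    moreover have "(\<lambda>\<omega>. num_points (\<Phi> \<omega> \<inter> W k) - num_points (\<Phi> \<omega> \<inter> W k \<inter> Pair \<omega> -` A)) \<in> borel_measurable N"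
      using compl(2) count[OF W(1)] by (intro borel_measurable_minus_ennreal)
    ultimately show ?case
      by (simp cong: measurable_cong)
  next
    case (union F)
    have "num_points (\<Phi> \<omega> \<inter> W k \<inter> Pair \<omega> -` (\<Union>i. F i)) = (\<Sum>i. num_points (\<Phi> \<omega> \<inter> W k \<inter> Pair \<omega> -` F i))" for \<omega>
      using union(1) by (subst suminf_emeasure) (auto simp: disjoint_family_on_def intro!: arg_cong[where f = "emeasure _"])
    then show ?case
      using union(3) by simp
  qed simp
  have "num_points (\<Phi> \<omega> \<inter> Pair \<omega> -` Q) = (SUP k. num_points (\<Phi> \<omega> \<inter> W k \<inter> Pair \<omega> -` Q))" if "\<omega> \<in> space N" for \<omega>
  proof -
    have "(SUP k. num_points (\<Phi> \<omega> \<inter> W k \<inter> Pair \<omega> -` Q)) = num_points (\<Union>k. \<Phi> \<omega> \<inter> W k \<inter> Pair \<omega> -` Q)"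
      using W(2) by (intro SUP_emeasure_incseq) (auto simp: incseq_def)
    also have "(\<Union>k. \<Phi> \<omega> \<inter> W k \<inter> Pair \<omega> -` Q) = \<Phi> \<omega> \<inter> Pair \<omega> -` Q"
      using sub[OF that] W(3) by blast
    finally show ?thesis ..
  qed
  moreover have "(\<lambda>\<omega>. SUP k. num_points (\<Phi> \<omega> \<inter> W k \<inter> Pair \<omega> -` Q)) \<in> borel_measurable N"
    using box by (intro borel_measurable_SUP) auto
  ultimately show ?thesis
    by (simp cong: measurable_cong)
qed

definition storm_value :: "'a::euclidean_space \<Rightarrow> 'a storm \<Rightarrow> real" where
  "storm_value s p = fst (snd p) * snd (snd p) (s - fst p)"

text \<open>The random function enters through its law \<open>PF\<close>.\<close>

locale storm_model = prob_space M
  for M :: "'w measure" +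
  fixes G :: "('a::euclidean_space \<Rightarrow> real) set"
    and PF :: "('a \<Rightarrow> real) measure"
    and L :: "'a storm measure"
    and \<Phi> :: "'w \<Rightarrow> 'a storm set"
  assumes countable_G: "countable G"
    and measurable_G: "\<And>f. f \<in> G \<Longrightarrow> f \<in> borel_measurable borel"
    and nonneg_G: "\<And>f x. f \<in> G \<Longrightarrow> 0 \<le> f x"
    and prob_PF: "prob_space PF"
    and sets_PF[measurable_cong]: "sets PF = sets (count_space G)"
    and integral_PF: "(\<integral>\<^sup>+f. (\<integral>\<^sup>+x. ennreal (f x) \<partial>lborel) \<partial>PF) = 1"
    and L_eq: "L = storm_intensity PF"
    and poisson: "poisson_point_process M G L \<Phi>"
begin

abbreviation N where "N \<equiv> process_algebra M L \<Phi>"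

lemma sets_L[measurable_cong]:
  "sets L = sets (lborel \<Otimes>\<^sub>M (restrict_space lborel {0<..} \<Otimes>\<^sub>M count_space G))"
  unfolding L_eq storm_intensity_def by (intro sets_pair_measure_cong sets_PF) auto

lemma space_L: "space L = storm_space G"
  using sets_eq_imp_space_eq[OF sets_L]
  by (simp add: space_pair_measure space_restrict_space storm_space_def)

lemma space_N[simp]: "space N = space M"
  unfolding process_algebra_def by (rule space_measure_of) auto

lemma borel_measurable_num_points[measurable (raw)]:
  assumes B: "B \<in> sets L"
  shows "(\<lambda>\<omega>. num_points (\<Phi> \<omega> \<inter> B)) \<in> borel_measurable N"
proof (rule measurableI)
  fix U :: "ennreal set" assume "U \<in> sets borel"
  then show "(\<lambda>\<omega>. num_points (\<Phi> \<omega> \<inter> B)) -` U \<inter> space N \<in> sets N"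
    unfolding space_N unfolding process_algebra_def
    by (subst sets_measure_of) (use B in \<open>auto intro!: sigma_sets.Basic\<close>)
qed simp

lemma \<Phi>_subset: "\<omega> \<in> space M \<Longrightarrow> \<Phi> \<omega> \<subseteq> storm_space G"
  using poisson by (auto simp: poisson_point_process_def locally_finite_storms_def)

lemma borel_measurable_num_points_random_set:
  assumes Q: "{x \<in> space (N \<Otimes>\<^sub>M L). snd x \<in> K (fst x)} \<in> sets (N \<Otimes>\<^sub>M L)"
  shows "(\<lambda>\<omega>. num_points (\<Phi> \<omega> \<inter> K \<omega>)) \<in> borel_measurable N"
proof -
  \<comment> \<open>an increasing sequence of finite unions of the boxes in which the process is locally finite\<close>
  let ?G = "\<lambda>k. {f \<in> G. to_nat_on G f \<le> k}"
  define W :: "nat \<Rightarrow> 'a storm set" where "W k = cball 0 (real k) \<times> {1 / (real k + 1) .. real k + 1} \<times> ?G k" for k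
  have finG: "finite (?G k)" for k
  proof (rule inj_on_finite[of "to_nat_on G" _ "{..k}"])
    show "inj_on (to_nat_on G) (?G k)"
      by (rule inj_on_subset[OF inj_on_to_nat_on[OF countable_G]]) auto
  qed auto
  have sect: "(\<lambda>\<omega>. num_points (\<Phi> \<omega> \<inter> Pair \<omega> -` {x \<in> space (N \<Otimes>\<^sub>M L). snd x \<in> K (fst x)})) \<in> borel_measurable N"
  proof (rule borel_measurable_num_points_section[OF borel_measurable_num_points _ _ _ _ _ Q, where W = W])
    show "\<Phi> \<omega> \<subseteq> space L" if "\<omega> \<in> space N" for \<omega>
      using \<Phi>_subset that by (simp add: space_L)
    show "W k \<in> sets L" for k
    proof -
      have "{1 / (real k + 1) .. real k + 1} \<in> sets (restrict_space lborel {0<..})"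
        by (subst sets_restrict_space_iff) (auto intro: less_le_trans[of 0 "1 / (real k + 1)"])
      then show ?thesis
        unfolding sets_L W_def by (intro pair_measureI) auto
    qed
    show "incseq W"
    proof (rule incseq_SucI)
      fix k
      have "1 / (real (Suc k) + 1) \<le> 1 / (real k + 1)"
        by (intro divide_left_mono) auto
      then show "W k \<le> W (Suc k)"
        unfolding W_def by (intro Sigma_mono) auto
    qed
    show "(\<Union>k. W k) = space L"
    proof (intro equalityI subsetI)
      fix p assume "p \<in> space L"
      then obtain x y f where p: "p = (x, y, f)" "0 < y" "f \<in> G"
        by (auto simp: space_L storm_space_def)
      obtain a :: nat where a: "norm x \<le> a" using real_arch_simple by blast
      obtain b :: nat where b: "y \<le> b" using real_arch_simple by blast
      obtain c :: nat where c: "1 / y \<le> c" using real_arch_simple by blast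
      define k where "k = max (max a b) (max c (to_nat_on G f))"
      have "norm x \<le> k" "y \<le> real k + 1" "1 / y \<le> real k + 1" "to_nat_on G f \<le> k"
        using a b c by (auto simp: k_def)
      then have "p \<in> W k"
        using p by (auto simp: W_def field_simps)
      then show "p \<in> (\<Union>k. W k)" by blast
    next
      fix p assume "p \<in> (\<Union>k. W k)"
      then show "p \<in> space L"
        by (auto simp: W_def space_L storm_space_def intro: less_le_trans[of 0 "1 / (real _ + 1)"])
    qed
    show "finite (\<Phi> \<omega> \<inter> W k)" if "\<omega> \<in> space N" for \<omega> k
    proof -
      have "locally_finite_storms G (\<Phi> \<omega>)"
        using poisson that by (auto simp: poisson_point_process_def)
      then have "finite (\<Phi> \<omega> \<inter> cball 0 (real k) \<times> {1 / (real k + 1) .. real k + 1} \<times> {f})" if "f \<in> G" for f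
      proof -
        have "{1 / (real k + 1) .. real k + 1} \<subseteq> {0<..}"
          by (auto intro: less_le_trans[of 0 "1 / (real k + 1)"])
        then show ?thesis
          using that \<open>locally_finite_storms G (\<Phi> \<omega>)\<close> unfolding locally_finite_storms_def by simp
      qed
      then have "finite (\<Union>f\<in>?G k. \<Phi> \<omega> \<inter> cball 0 (real k) \<times> {1 / (real k + 1) .. real k + 1} \<times> {f})"
        using finG by (intro finite_UN_I) auto
      then show ?thesis
        by (rule finite_subset[rotated]) (auto simp: W_def)
    qed
  qed
  have "\<Phi> \<omega> \<inter> K \<omega> = \<Phi> \<omega> \<inter> Pair \<omega> -` {x \<in> space (N \<Otimes>\<^sub>M L). snd x \<in> K (fst x)}"
    if "\<omega> \<in> space N" for \<omega>
    using \<Phi>_subset that by (auto simp: space_pair_measure space_L)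
  then show ?thesis
    using sect by (subst measurable_cong[OF arg_cong[where f = num_points]])
qed

lemma storm_space_sets_L[measurable]: "storm_space G \<in> sets L"
  unfolding space_L[symmetric] by (rule sets.top)

lemma borel_measurable_storm_height[measurable]: "(\<lambda>p. fst (snd p)) \<in> borel_measurable L"
proof -
  have "(\<lambda>p. fst (snd p)) \<in> L \<rightarrow>\<^sub>M restrict_space lborel {0<..}"
    by measurable
  then show ?thesis
    by (simp add: measurable_restrict_space2_iff)
qed

lemma borel_measurable_storm_shape[measurable]: "(\<lambda>p. (snd (snd p)) (s - fst p)) \<in> borel_measurable L"
proof -
  have [measurable]: "(\<lambda>p. snd (snd p)) \<in> L \<rightarrow>\<^sub>M count_space G" "fst \<in> L \<rightarrow>\<^sub>M borel"
    by measurable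
  show ?thesis
    by (rule measurable_compose_countable'[OF _ _ countable_G, where g = "\<lambda>p. snd (snd p)"])
      (use measurable_G in measurable)
qed

lemma borel_measurable_storm_value[measurable]: "storm_value s \<in> borel_measurable L"
  unfolding storm_value_def[abs_def] by measurable

text \<open>A supremum of an empty or unbounded set of reals is a fixed default value, and both situations can be
  detected by counting points. Otherwise the supremum exceeds \<open>a\<close> exactly if some storm does.\<close>

lemma borel_measurable_max_field: "(\<lambda>\<omega>. max_field (\<Phi> \<omega>) s) \<in> borel_measurable N"
proof (rule borel_measurableI_greater)
  fix a :: real
  define above where "above b = {p \<in> space L. b < storm_value s p}" for b
  have [measurable]: "above b \<in> sets L" for b
    unfolding above_def by measurable
  have above_iff: "num_points (\<Phi> \<omega> \<inter> above b) = 0 \<longleftrightarrow> (\<forall>p\<in>\<Phi> \<omega>. storm_value s p \<le> b)" if "\<omega> \<in> space N" for \<omega> b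
    using \<Phi>_subset[of \<omega>] that by (auto simp: emeasure_count_space_eq_0 above_def space_L not_less)
  have Sup: "max_field (\<Phi> \<omega>) s = Sup (storm_value s ` \<Phi> \<omega>)" for \<omega>
    by (simp add: max_field_def storm_value_def case_prod_unfold)
  have unbounded: "max_field (\<Phi> \<omega>) s = (LEAST z. False)"
    if "\<omega> \<in> space N" "\<forall>k::nat. num_points (\<Phi> \<omega> \<inter> above k) \<noteq> 0" for \<omega>
  proof -
    have "\<not> (\<forall>p\<in>\<Phi> \<omega>. storm_value s p \<le> z)" for z
      using that real_arch_simple[of z] unfolding above_iff[OF that(1)] by (meson order_trans)
    then have "(\<lambda>z. \<forall>x\<in>storm_value s ` \<Phi> \<omega>. x \<le> z) = (\<lambda>z. False)"
      by (intro ext) auto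
    then show ?thesis
      unfolding Sup Sup_real_def by simp
  qed
  have bounded: "a < max_field (\<Phi> \<omega>) s \<longleftrightarrow> num_points (\<Phi> \<omega> \<inter> above a) \<noteq> 0"
    if "\<omega> \<in> space N" "num_points (\<Phi> \<omega> \<inter> space L) \<noteq> 0" "num_points (\<Phi> \<omega> \<inter> above (real k)) = 0" for \<omega> k
  proof -
    have "storm_value s ` \<Phi> \<omega> \<noteq> {}"
      using that(2) by auto
    moreover have "bdd_above (storm_value s ` \<Phi> \<omega>)"
      using that(3) unfolding above_iff[OF that(1)] by (auto simp: bdd_above_def)
    ultimately show ?thesis
      unfolding Sup above_iff[OF that(1)] by (auto simp: less_cSup_iff not_le)
  qed
  have empty: "max_field (\<Phi> \<omega>) s = Sup {}" if "\<omega> \<in> space N" "num_points (\<Phi> \<omega> \<inter> space L) = 0" for \<omega>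
  proof -
    have "\<Phi> \<omega> = {}"
      using that \<Phi>_subset[of \<omega>] by (auto simp: emeasure_count_space_eq_0 space_L)
    then show ?thesis by (simp add: max_field_def)
  qed
  have "{\<omega> \<in> space N. a < max_field (\<Phi> \<omega>) s} =
     {\<omega> \<in> space N. if num_points (\<Phi> \<omega> \<inter> space L) = 0 then a < Sup {}
        else if \<forall>k::nat. num_points (\<Phi> \<omega> \<inter> above k) \<noteq> 0 then a < (LEAST z. False)
        else num_points (\<Phi> \<omega> \<inter> above a) \<noteq> 0}"
    using empty unbounded bounded by (intro Collect_cong) (auto simp del: space_N)
  also have "\<dots> \<in> sets N"
    by measurable
  finally show "{\<omega> \<in> space N. a < max_field (\<Phi> \<omega>) s} \<in> sets N" .
qed

lemma borel_measurable_max_vec: "(\<lambda>\<omega>. max_vec t (\<Phi> \<omega>) :: real ^ 'n::finite) \<in> borel_measurable N"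
  by (rule borel_measurable_euclidean_space[THEN iffD2])
    (auto simp: Basis_vec_def inner_axis max_vec_def borel_measurable_max_field)

end

section \<open>Finiteness of the storms above a level\<close>

lemma nn_integral_inverse_square_tail:
  fixes b :: real
  assumes "0 < b"
  shows "(\<integral>\<^sup>+u\<in>{b..}. ennreal (1 / u\<^sup>2) \<partial>lborel) = ennreal (1 / b)"
proof -
  have "((\<lambda>u::real. - (1 / u)) \<longlongrightarrow> 0) at_top"
    by real_asymp
  then have "(\<integral>\<^sup>+u\<in>{b..}. ennreal (1 / u\<^sup>2) \<partial>lborel) = ennreal (0 - - (1 / b))"
    using assms
    by (intro nn_integral_FTC_atLeast)
      (auto intro!: derivative_eq_intros simp: power2_eq_square)
  then show ?thesis by simp
qed

lemma nn_integral_lborel_reflect_shift: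
  fixes f :: "'a::euclidean_space \<Rightarrow> ennreal"
  assumes [measurable]: "f \<in> borel_measurable borel"
  shows "(\<integral>\<^sup>+x. f (s - x) \<partial>lborel) = (\<integral>\<^sup>+x. f x \<partial>lborel)"
proof -
  have "(\<integral>\<^sup>+x. f x \<partial>lborel) = (\<integral>\<^sup>+x. f x \<partial>density (distr lborel borel (\<lambda>x. s + (-1) *\<^sub>R x)) (\<lambda>_. ennreal (\<bar>-1\<bar> ^ DIM('a))))"
    using lborel_affine_euclidean by (subst lborel_affine[of "-1" s]) auto
  also have "\<dots> = (\<integral>\<^sup>+x. f (s - x) \<partial>lborel)"
    by (simp add: nn_integral_density nn_integral_distr)
  finally show ?thesis ..
qed

context storm_model
begin

text \<open>For fixed \<open>x\<close> and \<open>f\<close> the condition \<open>u f(s - x) > a\<close> cuts off the tail of \<open>u\<^sup>-\<^sup>2\<close> at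
  \<open>a / f(s - x)\<close>, which has mass \<open>f(s - x) / a\<close>. Integrating over \<open>x\<close> and \<open>f\<close> gives \<open>1 / a\<close> by the
  normalisation of the random function.\<close>

lemma emeasure_storms_above_finite:
  assumes a: "0 < a"
  shows "emeasure L {p \<in> space L. a < storm_value s p} < \<infinity>"
proof -
  define D where "D = density (restrict_space lborel {0::real<..}) (\<lambda>u. ennreal (1 / u\<^sup>2))"
  interpret P: prob_space PF by (rule prob_PF)
  have "sigma_finite_measure (restrict_space (lborel :: real measure) {0<..})"
    by (intro sigma_finite_measure_restrict_space sigma_finite_lborel) auto
  then have D_sf: "sigma_finite_measure D"
    unfolding D_def
    by (subst sigma_finite_measure.sigma_finite_iff_density_finite) (auto intro!: measurable_restrict_space1)
  interpret D: sigma_finite_measure D by (rule D_sf)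
  interpret DP: pair_sigma_finite D PF by unfold_locales
  interpret XDP: pair_sigma_finite lborel "D \<Otimes>\<^sub>M PF"
    by (intro pair_sigma_finite.intro sigma_finite_lborel DP.sigma_finite_measure_axioms)
  interpret XP: pair_sigma_finite lborel PF by unfold_locales
  have L: "L = lborel \<Otimes>\<^sub>M (D \<Otimes>\<^sub>M PF)"
    by (simp add: L_eq storm_intensity_def D_def)
  define g :: "'a storm \<Rightarrow> ennreal" where "g p = indicator {p \<in> space L. a < storm_value s p} p" for p :: "'a storm"
  have g[measurable]: "g \<in> borel_measurable (lborel \<Otimes>\<^sub>M (D \<Otimes>\<^sub>M PF))"
    unfolding g_def by (fold L) measurable
  have space_PF: "space PF = G" using sets_eq_imp_space_eq[OF sets_PF] by simp
  have inner: "(\<integral>\<^sup>+u. g (x, u, f) \<partial>D) \<le> ennreal (1 / a) * ennreal (f (s - x))" if "f \<in> G" for x f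
  proof (cases "f (s - x) = 0")
    case True
    then have "g (x, u, f) = 0" for u
      using a by (auto simp: g_def storm_value_def)
    then show ?thesis by simp
  next
    case False
    then have c: "0 < f (s - x)" using nonneg_G[OF that, of "s - x"] by simp
    have "(\<integral>\<^sup>+u. g (x, u, f) \<partial>D) \<le> (\<integral>\<^sup>+u. indicator {a / f (s - x)..} u \<partial>D)"
      using c by (intro nn_integral_mono) (auto simp: g_def storm_value_def field_simps split: split_indicator)
    also have "\<dots> = (\<integral>\<^sup>+u. ennreal (1 / u\<^sup>2) * indicator {a / f (s - x)..} u * indicator {0<..} u \<partial>lborel)"
      unfolding D_def
      by (subst nn_integral_density) (auto simp: nn_integral_restrict_space intro!: measurable_restrict_space1)
    also have "\<dots> \<le> (\<integral>\<^sup>+u\<in>{a / f (s - x)..}. ennreal (1 / u\<^sup>2) \<partial>lborel)"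
      by (intro nn_integral_mono) (auto split: split_indicator)
    also have "\<dots> = ennreal (1 / a) * ennreal (f (s - x))"
      using a c by (subst nn_integral_inverse_square_tail) (auto simp flip: ennreal_mult)
    finally show ?thesis .
  qed
  have [measurable]: "(\<lambda>(x, f). ennreal (f (s - x))) \<in> borel_measurable (lborel \<Otimes>\<^sub>M PF)"
  proof -
    have [measurable]: "snd \<in> lborel \<Otimes>\<^sub>M PF \<rightarrow>\<^sub>M count_space G"
      by measurable
    have "(\<lambda>p. ennreal ((snd p) (s - fst p))) \<in> borel_measurable (lborel \<Otimes>\<^sub>M PF)"
      by (rule measurable_compose_countable'[OF _ _ countable_G, where g = snd])
        (use measurable_G in measurable)
    then show ?thesis by (simp add: case_prod_unfold)
  qed
  have "emeasure L {p \<in> space L. a < storm_value s p} = (\<integral>\<^sup>+p. g p \<partial>L)"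
    by (simp add: g_def)
  also have "\<dots> = (\<integral>\<^sup>+p. g p \<partial>(lborel \<Otimes>\<^sub>M (D \<Otimes>\<^sub>M PF)))"
    by (simp only: L)
  also have "\<dots> = (\<integral>\<^sup>+x. (\<integral>\<^sup>+q. g (x, q) \<partial>(D \<Otimes>\<^sub>M PF)) \<partial>lborel)"
    by (rule DP.nn_integral_fst[symmetric]) (rule g)
  also have "\<dots> = (\<integral>\<^sup>+x. (\<integral>\<^sup>+f. (\<integral>\<^sup>+u. g (x, u, f) \<partial>D) \<partial>PF) \<partial>lborel)"
    by (subst DP.nn_integral_snd[symmetric]) (simp_all add: split_beta')
  also have "\<dots> \<le> (\<integral>\<^sup>+x. (\<integral>\<^sup>+f. ennreal (1 / a) * ennreal (f (s - x)) \<partial>PF) \<partial>lborel)"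
    using inner by (intro nn_integral_mono) (simp add: space_PF)
  also have "\<dots> = (\<integral>\<^sup>+f. (\<integral>\<^sup>+x. ennreal (1 / a) * ennreal (f (s - x)) \<partial>lborel) \<partial>PF)"
    by (rule XP.Fubini'[symmetric]) measurable
  also have "\<dots> = (\<integral>\<^sup>+f. ennreal (1 / a) * (\<integral>\<^sup>+x. ennreal (f x) \<partial>lborel) \<partial>PF)"
    using measurable_G
    by (intro nn_integral_cong)
      (simp add: space_PF nn_integral_cmult nn_integral_lborel_reflect_shift[where f = "\<lambda>x. ennreal (_ x)"])
  also have "\<dots> = ennreal (1 / a)"
    using sets_PF
    by (subst nn_integral_cmult) (auto simp: integral_PF measurable_cong_sets[OF sets_PF refl])
  finally show ?thesis
    using le_less_trans[OF _ ennreal_less_top] by auto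
qed

text \<open>The Poisson probabilities of the finite counts sum to 1.\<close>

lemma AE_num_points_finite:
  assumes B: "B \<in> sets L" and fin: "emeasure L B < \<infinity>"
  shows "AE \<omega> in M. num_points (\<Phi> \<omega> \<inter> B) < \<infinity>"
proof -
  let ?l = "measure L B"
  have [measurable]: "(\<lambda>\<omega>. num_points (\<Phi> \<omega> \<inter> B)) \<in> borel_measurable M"
    and P: "\<And>k::nat. \<P>(\<omega> in M. num_points (\<Phi> \<omega> \<inter> B) = of_nat k) = ?l ^ k / fact k * exp (- ?l)"
    using poisson B fin by (auto simp: poisson_point_process_def)
  define C where "C k = {\<omega> \<in> space M. num_points (\<Phi> \<omega> \<inter> B) = of_nat k}" for k :: nat
  have C[measurable]: "C k \<in> sets M" for k
    unfolding C_def by measurable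
  have "(\<lambda>k. measure M (C k)) sums measure M (\<Union>k. C k)"
    by (intro finite_measure_UNION) (auto simp: disjoint_family_on_def C_def)
  moreover have "(\<lambda>k. measure M (C k)) sums 1"
  proof -
    have "(\<lambda>k. ?l ^ k / fact k * exp (- ?l)) sums (exp ?l * exp (- ?l))"
      using exp_converges[of ?l] by (intro sums_mult2) (simp add: field_simps)
    then show ?thesis by (simp add: C_def P flip: exp_add)
  qed
  ultimately have "prob (\<Union>k. C k) = 1"
    by (rule sums_unique2)
  then have "AE \<omega> in M. \<omega> \<in> (\<Union>k. C k)"
    by (subst (asm) prob_eq_1) auto
  then show ?thesis
    by eventually_elim (auto simp: C_def of_nat_less_top)
qed

lemma AE_finite_storms_above:
  "AE \<omega> in M. \<forall>a>0. finite {p \<in> \<Phi> \<omega>. a < storm_value s p}"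
proof -
  let ?B = "\<lambda>k::nat. {p \<in> space L. inverse (real (Suc k)) < storm_value s p}"
  have "AE \<omega> in M. \<forall>k. num_points (\<Phi> \<omega> \<inter> ?B k) < \<infinity>"
    unfolding AE_all_countable
    by (intro allI AE_num_points_finite emeasure_storms_above_finite) auto
  then show ?thesis
    using AE_space
  proof eventually_elim
    case (elim \<omega>)
    show ?case
    proof (intro allI impI)
      fix a :: real assume "0 < a"
      then obtain k where "inverse (real (Suc k)) < a"
        using reals_Archimedean by blast
      then have "{p \<in> \<Phi> \<omega>. a < storm_value s p} \<subseteq> \<Phi> \<omega> \<inter> ?B k"
        using \<Phi>_subset[OF elim(2)] by (auto simp: space_L)
      moreover have "finite (\<Phi> \<omega> \<inter> ?B k)"
        using elim(1)[rule_format, of k] by (auto simp: emeasure_count_space split: if_splits)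
      ultimately show "finite {p \<in> \<Phi> \<omega>. a < storm_value s p}"
        by (rule finite_subset)
    qed
  qed
qed

end

section \<open>Blurred and exact sets of storms\<close>

lemma mem_K_bar: "p \<in> K_bar G t z \<longleftrightarrow> p \<in> storm_space G \<and> (\<exists>j. z $ j < storm_value (t j) p)"
  by (cases p) (simp add: K_bar_def storm_value_def)

lemma mem_I_set: "p \<in> I_set G t A z \<longleftrightarrow> p \<in> storm_space G \<and>
    (\<forall>i. if i \<in> A then storm_value (t i) p = z $ i else storm_value (t i) p < z $ i)"
  by (cases p) (auto simp: I_set_def storm_value_def)

lemma mem_K_blur: "p \<in> K_blur G m t z \<longleftrightarrow> p \<in> storm_space G \<and>
    (\<forall>i. storm_value (t i) p \<le> (real (cell_index m (z $ i)) + 1) / 2 ^ m) \<and>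
    (\<exists>i. storm_value (t i) p \<in> cell m (z $ i))"
  by (cases p) (simp add: K_blur_def storm_value_def)

lemma mem_K_bar_blur: "p \<in> K_bar_blur G m t z \<longleftrightarrow> p \<in> storm_space G \<and>
    (\<exists>i. (real (cell_index m (z $ i)) + 1) / 2 ^ m < storm_value (t i) p)"
  by (cases p) (simp add: K_bar_blur_def storm_value_def)

lemma mem_I_blur: "p \<in> I_blur G m t A z \<longleftrightarrow> p \<in> K_blur G m t z \<and>
    (\<forall>i. storm_value (t i) p \<in> cell m (z $ i) \<longleftrightarrow> i \<in> A)"
  by (cases p) (auto simp: I_blur_def K_blur_def K_blur1_def storm_value_def)

text \<open>This description holds for every \<open>z\<close> and is used for measurability; the simpler \<open>mem_K_set\<close> below
  is only valid for positive \<open>z\<close>.\<close>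

lemma mem_K_set_ennreal: "p \<in> K_set G t z \<longleftrightarrow> p \<in> storm_space G \<and>
    (\<forall>i. ennreal (fst (snd p)) \<le> ennreal (z $ i) / ennreal (snd (snd p) (t i - fst p))) \<and>
    (\<exists>i. ennreal (fst (snd p)) = ennreal (z $ i) / ennreal (snd (snd p) (t i - fst p)))"
  by (cases p) (auto simp: K_set_def eq_Min_iff)

lemma mem_K_set:
  assumes nonneg: "\<And>f x. f \<in> G \<Longrightarrow> 0 \<le> f x" and z: "\<And>i. 0 < z $ i"
  shows "p \<in> K_set G t z \<longleftrightarrow> p \<in> storm_space G \<and>
    (\<forall>i. storm_value (t i) p \<le> z $ i) \<and> (\<exists>i. storm_value (t i) p = z $ i)"
proof (cases "p \<in> storm_space G")
  case True
  then obtain x y f where p: "p = (x, y, f)" "0 < y" "f \<in> G"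
    by (auto simp: storm_space_def)
  have "ennreal y \<le> ennreal (z $ i) / ennreal (f (t i - x)) \<longleftrightarrow> y * f (t i - x) \<le> z $ i"
    and "ennreal y = ennreal (z $ i) / ennreal (f (t i - x)) \<longleftrightarrow> y * f (t i - x) = z $ i" for i
  proof -
    consider "f (t i - x) = 0" | "0 < f (t i - x)"
      using nonneg[OF p(3), of "t i - x"] by linarith
    then have "(ennreal y \<le> ennreal (z $ i) / ennreal (f (t i - x)) \<longleftrightarrow> y * f (t i - x) \<le> z $ i) \<and>
      (ennreal y = ennreal (z $ i) / ennreal (f (t i - x)) \<longleftrightarrow> y * f (t i - x) = z $ i)"
    proof cases
      case 1
      then show ?thesis using z[of i] by (simp add: ennreal_divide_zero)
    next
      case 2
      then have "ennreal (z $ i) / ennreal (f (t i - x)) = ennreal (z $ i / f (t i - x))"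
        using z[of i] by (simp add: divide_ennreal)
      then show ?thesis
        using 2 z[of i] p(2) by (simp add: field_simps)
    qed
    then show "ennreal y \<le> ennreal (z $ i) / ennreal (f (t i - x)) \<longleftrightarrow> y * f (t i - x) \<le> z $ i"
      and "ennreal y = ennreal (z $ i) / ennreal (f (t i - x)) \<longleftrightarrow> y * f (t i - x) = z $ i" by auto
  qed
  with True p show ?thesis
    by (simp add: mem_K_set_ennreal storm_value_def)
qed (simp add: mem_K_set_ennreal)

lemma mem_cell_iff: "v \<in> cell m z \<longleftrightarrow> real (cell_index m z) / 2 ^ m < v \<and> v \<le> (real (cell_index m z) + 1) / 2 ^ m"
  by (simp add: cell_def)

lemma mem_cellD:
  assumes "0 < z" "w \<in> cell m z"
  shows "0 < w" "cell_index m w = cell_index m z"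
proof -
  show "0 < w"
    using assms(2) by (auto simp: cell_def intro: le_less_trans[of 0 "real _ / 2 ^ m"])
  then show "cell_index m w = cell_index m z"
    using assms by (simp add: cell_eq_ceiling cell_index_eq)
qed

lemma blur_cong:
  assumes "\<And>i. cell_index m (w $ i) = cell_index m (z $ i)"
  shows "K_blur G m t w = K_blur G m t z" "K_bar_blur G m t w = K_bar_blur G m t z"
    "I_blur G m t A w = I_blur G m t A z"
proof -
  have "cell m (w $ i) = cell m (z $ i)" for i
    using assms by (simp add: cell_def)
  with assms show "K_blur G m t w = K_blur G m t z" "K_bar_blur G m t w = K_bar_blur G m t z"
    "I_blur G m t A w = I_blur G m t A z"
    by (simp_all add: set_eq_iff mem_K_blur mem_K_bar_blur mem_I_blur)
qed

text \<open>Values in \<open>V\<close> other than \<open>z\<close> are either at most \<open>z / 2\<close> or are among finitely many, so they stay away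
  from \<open>z\<close> by a distance \<open>e\<close>; cells shorter than \<open>e\<close> contain none of them.\<close>

lemma eventually_mem_cell_iff_eq_finite:
  assumes z: "0 < z" and le: "\<And>v. v \<in> V \<Longrightarrow> v \<le> z" and fin: "finite {v \<in> V. z / 2 < v}"
  shows "\<forall>\<^sub>F m in sequentially. \<forall>v\<in>V. v \<in> cell m z \<longleftrightarrow> v = z"
proof -
  obtain e where e: "0 < e" "e \<le> z / 2" "\<And>v. v \<in> V \<Longrightarrow> v \<noteq> z \<Longrightarrow> v \<le> z - e"
  proof -
    define F where "F = insert (z / 2) {v \<in> V. z / 2 < v \<and> v \<noteq> z}"
    have F: "finite F" "F \<noteq> {}"
      using fin by (auto simp: F_def intro: rev_finite_subset)
    have "v < z" if "v \<in> F" for v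
      using that z le by (force simp: F_def)
    then have "Max F < z" using F by simp
    moreover have "z / 2 \<le> Max F" using F(1) by (rule Max_ge) (simp add: F_def)
    moreover have "v \<le> Max F" if "v \<in> V" "v \<noteq> z" for v
    proof (cases "z / 2 < v")
      case True
      then show ?thesis using F that by (intro Max_ge) (auto simp: F_def)
    next
      case False
      with \<open>z / 2 \<le> Max F\<close> show ?thesis by linarith
    qed
    ultimately show thesis
      by (intro that[of "z - Max F"]) auto
  qed
  have "(\<lambda>m. (1 / 2 :: real) ^ m) \<longlonglongrightarrow> 0"
    by (intro LIMSEQ_power_zero) auto
  from order_tendstoD(2)[OF this e(1)] show ?thesis
  proof eventually_elim
    case (elim m)
    have zc: "z \<in> cell m z" by (rule mem_cell[OF z])
    have "v = z" if "v \<in> V" "v \<in> cell m z" for v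
    proof (rule ccontr)
      assume "v \<noteq> z"
      then have "v \<le> z - e" using e(3) that by simp
      moreover have "z - (1 / 2) ^ m < v"
        using zc that(2) by (simp add: mem_cell_iff add_divide_distrib power_one_over)
      ultimately show False using elim by linarith
    qed
    with zc show ?case by auto
  qed
qed

text \<open>All storms of \<open>X\<close> are at most \<open>z\<close> at every site, hence at most the upper ends of the cells of \<open>z\<close>. What distinguishes the
  blurred sets from the exact ones is therefore only whether being in the cell of \<open>z\<close> means being equal to \<open>z\<close>,
  which for large \<open>m\<close> it does, for all points and sites at once.\<close>

lemma blurred_sets_eventually_exact:
  fixes t :: "'n::finite \<Rightarrow> 'a::euclidean_space" and X :: "'a storm set"
  defines "z \<equiv> max_vec t X"
  assumes nonneg: "\<And>f x. f \<in> G \<Longrightarrow> 0 \<le> f x" and X: "X \<subseteq> storm_space G"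
    and z: "\<And>i. 0 < z $ i"
    and fin: "\<And>a i. 0 < a \<Longrightarrow> finite {p \<in> X. a < storm_value (t i) p}"
  shows "X \<inter> K_bar G t z = {} \<and> (\<forall>\<^sub>F m in sequentially. X \<inter> K_bar_blur G m t z = {} \<and>
    X \<inter> K_blur G m t z = X \<inter> K_set G t z \<and>
    (\<forall>A. A \<noteq> {} \<longrightarrow> X \<inter> I_blur G m t A z = X \<inter> I_set G t A z))"
proof
  have le: "storm_value (t i) p \<le> z $ i" if "p \<in> X" for p i
  proof -
    have "storm_value (t i) ` X \<subseteq> {..1} \<union> storm_value (t i) ` {p \<in> X. 1 < storm_value (t i) p}"
      by force
    moreover have "bdd_above ({..1} \<union> storm_value (t i) ` {p \<in> X. 1 < storm_value (t i) p})"
      using fin[of 1 i] by simp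
    ultimately have "bdd_above (storm_value (t i) ` X)"
      by (rule bdd_above_mono[rotated])
    then show ?thesis
      using that by (simp add: z_def max_vec_def max_field_def case_prod_unfold cSUP_upper flip: storm_value_def)
  qed
  have top: "z $ i \<le> (real (cell_index m (z $ i)) + 1) / 2 ^ m" for i m
    using mem_cell[OF z, of i m] by (simp add: mem_cell_iff)
  show "X \<inter> K_bar G t z = {}"
    unfolding disjoint_iff mem_K_bar using le by (meson not_le)
  have K_bar_blur: "X \<inter> K_bar_blur G m t z = {}" for m
    unfolding disjoint_iff mem_K_bar_blur using order_trans[OF le top] by (meson not_le)
  have mem_K: "p \<in> K_set G t z \<longleftrightarrow> p \<in> storm_space G \<and>
      (\<forall>i. storm_value (t i) p \<le> z $ i) \<and> (\<exists>i. storm_value (t i) p = z $ i)" for p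
    by (rule mem_K_set) (fact nonneg z)+
  have "\<forall>\<^sub>F m in sequentially. \<forall>i. \<forall>v\<in>storm_value (t i) ` X. v \<in> cell m (z $ i) \<longleftrightarrow> v = z $ i"
  proof (intro eventually_all_finite eventually_mem_cell_iff_eq_finite z)
    fix i
    have "{v \<in> storm_value (t i) ` X. z $ i / 2 < v} = storm_value (t i) ` {p \<in> X. z $ i / 2 < storm_value (t i) p}"
      by auto
    then show "finite {v \<in> storm_value (t i) ` X. z $ i / 2 < v}"
      using fin[of "z $ i / 2" i] z[of i] by simp
  qed (use le in auto)
  then show "\<forall>\<^sub>F m in sequentially. X \<inter> K_bar_blur G m t z = {} \<and>
      X \<inter> K_blur G m t z = X \<inter> K_set G t z \<and>
      (\<forall>A. A \<noteq> {} \<longrightarrow> X \<inter> I_blur G m t A z = X \<inter> I_set G t A z)"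
  proof eventually_elim
    case (elim m)
    then have cell: "storm_value (t i) p \<in> cell m (z $ i) \<longleftrightarrow> storm_value (t i) p = z $ i" if "p \<in> X" for p i
      using that by auto
    have K: "p \<in> K_blur G m t z \<longleftrightarrow> p \<in> K_set G t z" if "p \<in> X" for p
      using le[OF that] order_trans[OF le[OF that] top]
      by (simp add: mem_K mem_K_blur cell[OF that])
    have "p \<in> I_blur G m t A z \<longleftrightarrow> p \<in> I_set G t A z" if p: "p \<in> X" and A: "A \<noteq> {}" for p A
      unfolding mem_I_blur K[OF p] mem_K mem_I_set cell[OF p]
      using le[OF p] A by (auto simp: less_le)
    with K K_bar_blur show ?case by blast
  qed
qed

text \<open>No cell contains a nonpositive number, so there the index is the default value of a definite
  description that does not depend on \<open>z\<close>.\<close>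

lemma borel_measurable_cell_index[measurable]: "(\<lambda>z. real (cell_index m z)) \<in> borel_measurable borel"
proof -
  have "cell_index m z = (if 0 < z then nat (\<lceil>2 ^ m * z\<rceil> - 1) else (THE j. False))" for z
  proof (cases "0 < z")
    case False
    then have "\<not> real j / 2 ^ m < z" for j
      using order_trans[of z 0 "real j / 2 ^ m"] by (simp add: not_less)
    with False show ?thesis by (simp add: cell_index_def)
  qed (simp add: cell_index_eq)
  then show ?thesis by simp
qed

context storm_model
begin

lemma random_sets_measurable:
  fixes t :: "'n::finite \<Rightarrow> 'a" and Z :: "'w \<Rightarrow> real ^ 'n"
  assumes Z[measurable]: "Z \<in> borel_measurable N"
  shows "{x \<in> space (N \<Otimes>\<^sub>M L). snd x \<in> K_bar G t (Z (fst x))} \<in> sets (N \<Otimes>\<^sub>M L)"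
    and "{x \<in> space (N \<Otimes>\<^sub>M L). snd x \<in> K_set G t (Z (fst x))} \<in> sets (N \<Otimes>\<^sub>M L)"
    and "{x \<in> space (N \<Otimes>\<^sub>M L). snd x \<in> I_set G t A (Z (fst x))} \<in> sets (N \<Otimes>\<^sub>M L)"
    and "{x \<in> space (N \<Otimes>\<^sub>M L). snd x \<in> K_bar_blur G m t (Z (fst x))} \<in> sets (N \<Otimes>\<^sub>M L)"
    and "{x \<in> space (N \<Otimes>\<^sub>M L). snd x \<in> K_blur G m t (Z (fst x))} \<in> sets (N \<Otimes>\<^sub>M L)"
    and "{x \<in> space (N \<Otimes>\<^sub>M L). snd x \<in> I_blur G m t A (Z (fst x))} \<in> sets (N \<Otimes>\<^sub>M L)"
proof -
  have [measurable]: "(\<lambda>\<omega>. Z \<omega> $ i) \<in> borel_measurable N" for i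
    using measurable_compose[OF Z borel_measurable_nth] .
  have [measurable]: "(\<lambda>\<omega>. real (cell_index m (Z \<omega> $ i))) \<in> borel_measurable N" for i m
    by (rule measurable_compose[OF _ borel_measurable_cell_index]) measurable
  show "{x \<in> space (N \<Otimes>\<^sub>M L). snd x \<in> K_bar G t (Z (fst x))} \<in> sets (N \<Otimes>\<^sub>M L)"
    unfolding mem_K_bar by measurable
  show "{x \<in> space (N \<Otimes>\<^sub>M L). snd x \<in> K_set G t (Z (fst x))} \<in> sets (N \<Otimes>\<^sub>M L)"
    unfolding mem_K_set_ennreal by measurable
  show "{x \<in> space (N \<Otimes>\<^sub>M L). snd x \<in> I_set G t A (Z (fst x))} \<in> sets (N \<Otimes>\<^sub>M L)"
    unfolding mem_I_set by measurable
  show "{x \<in> space (N \<Otimes>\<^sub>M L). snd x \<in> K_bar_blur G m t (Z (fst x))} \<in> sets (N \<Otimes>\<^sub>M L)"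
    unfolding mem_K_bar_blur by measurable
  show "{x \<in> space (N \<Otimes>\<^sub>M L). snd x \<in> K_blur G m t (Z (fst x))} \<in> sets (N \<Otimes>\<^sub>M L)"
    unfolding mem_K_blur mem_cell_iff by measurable
  show "{x \<in> space (N \<Otimes>\<^sub>M L). snd x \<in> I_blur G m t A (Z (fst x))} \<in> sets (N \<Otimes>\<^sub>M L)"
    unfolding mem_I_blur mem_K_blur mem_cell_iff by measurable
qed

end

section \<open>Convergence for a single event\<close>

context storm_model
begin

context
  fixes t :: "'n::finite \<Rightarrow> 'a" and Z :: "'w \<Rightarrow> real ^ 'n" and \<kappa> :: "real ^ 'n \<Rightarrow> 'w measure"
  assumes Z_eq: "Z = (\<lambda>\<omega>. max_vec t (\<Phi> \<omega>))"
    and kernel: "regular_cond_prob M N borel Z \<kappa>"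
begin

lemma Z_measurable_N[measurable]: "Z \<in> borel_measurable N"
  unfolding Z_eq by (rule borel_measurable_max_vec)

lemma space_kernel: "space (\<kappa> z) = space M"
proof -
  have "\<kappa> \<in> borel \<rightarrow>\<^sub>M prob_algebra N"
    using kernel by (simp add: regular_cond_prob_def)
  from measurable_space[OF this, of z] have "sets (\<kappa> z) = sets N"
    by (simp add: space_prob_algebra)
  then show ?thesis
    using sets_eq_imp_space_eq space_N by metis
qed

lemma AE_positive_eventually_exact:
  "AE \<omega> in M. (\<forall>i. 0 < Z \<omega> $ i) \<longrightarrow> \<Phi> \<omega> \<inter> K_bar G t (Z \<omega>) = {} \<and>
     (\<forall>\<^sub>F m in sequentially. \<Phi> \<omega> \<inter> K_bar_blur G m t (Z \<omega>) = {} \<and>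
       \<Phi> \<omega> \<inter> K_blur G m t (Z \<omega>) = \<Phi> \<omega> \<inter> K_set G t (Z \<omega>) \<and>
       (\<forall>A. A \<noteq> {} \<longrightarrow> \<Phi> \<omega> \<inter> I_blur G m t A (Z \<omega>) = \<Phi> \<omega> \<inter> I_set G t A (Z \<omega>)))"
proof -
  have "AE \<omega> in M. \<forall>i. \<forall>a>0. finite {p \<in> \<Phi> \<omega>. a < storm_value (t i) p}"
    unfolding AE_all_countable using AE_finite_storms_above by blast
  then show ?thesis
    using AE_space
  proof eventually_elim
    case (elim \<omega>)
    then have fin: "finite {p \<in> \<Phi> \<omega>. a < storm_value (t i) p}" if "0 < a" for a i
      using that by auto
    show ?case
    proof
      assume "\<forall>i. 0 < Z \<omega> $ i"
      then have pos: "0 < max_vec t (\<Phi> \<omega>) $ i" for i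
        by (simp add: Z_eq)
      then show "\<Phi> \<omega> \<inter> K_bar G t (Z \<omega>) = {} \<and>
         (\<forall>\<^sub>F m in sequentially. \<Phi> \<omega> \<inter> K_bar_blur G m t (Z \<omega>) = {} \<and>
           \<Phi> \<omega> \<inter> K_blur G m t (Z \<omega>) = \<Phi> \<omega> \<inter> K_set G t (Z \<omega>) \<and>
           (\<forall>A. A \<noteq> {} \<longrightarrow> \<Phi> \<omega> \<inter> I_blur G m t A (Z \<omega>) = \<Phi> \<omega> \<inter> I_set G t A (Z \<omega>)))"
        unfolding Z_eq by (intro blurred_sets_eventually_exact nonneg_G \<Phi>_subset elim(2) fin)
    qed
  qed
qed

text \<open>The assumption \<open>Qm_cong\<close> says that \<open>Qm m z\<close> depends on \<open>z\<close> only through its cell at level \<open>m\<close>. Given that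
  \<open>Z\<close> is in this cell, \<open>z\<close> may thus be replaced by \<open>Z\<close>, which leaves an event that does not depend
  on \<open>z\<close>.\<close>

lemma AE_cond_prob_tendsto_kernel:
  fixes Q :: "real ^ 'n \<Rightarrow> 'w \<Rightarrow> bool" and Qm :: "nat \<Rightarrow> real ^ 'n \<Rightarrow> 'w \<Rightarrow> bool"
  assumes Q: "{\<omega> \<in> space N. Q (Z \<omega>) \<omega>} \<in> sets N"
    and Qm: "\<And>m. {\<omega> \<in> space N. Qm m (Z \<omega>) \<omega>} \<in> sets N"
    and Qm_cong: "\<And>m z w \<omega>. (\<And>i. cell_index m (w $ i) = cell_index m (z $ i)) \<Longrightarrow> Qm m w \<omega> = Qm m z \<omega>"
    and ev: "AE \<omega> in M. (\<forall>i. 0 < Z \<omega> $ i) \<longrightarrow> (\<forall>\<^sub>F m in sequentially. Qm m (Z \<omega>) \<omega> \<longleftrightarrow> Q (Z \<omega>) \<omega>)"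
  shows "AE z in distr M borel Z. (\<forall>i. 0 < z $ i) \<longrightarrow>
    (\<lambda>m. \<P>(\<omega> in M. Qm m z \<omega> \<bar> Z \<omega> \<in> cell_vec m z)) \<longlonglongrightarrow> \<P>(\<omega> in \<kappa> z. Q (Z \<omega>) \<omega>)"
proof -
  let ?E = "{\<omega> \<in> space M. Q (Z \<omega>) \<omega>}" and ?Em = "\<lambda>m. {\<omega> \<in> space M. Qm m (Z \<omega>) \<omega>}"
  have "AE z in distr M borel Z. z \<in> {z. \<forall>i. 0 < z $ i} \<longrightarrow>
    (\<lambda>m. measure M (?Em m \<inter> (Z -` level_set (dyadic_index m) z \<inter> space M)) /
        measure M (Z -` level_set (dyadic_index m) z \<inter> space M)) \<longlonglongrightarrow> measure (\<kappa> z) ?E"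
  proof (rule dyadic.AE_cond_level_set_tendsto_kernel_eventually[OF prob_space_axioms kernel])
    show "?E \<in> sets N" "?Em m \<in> sets N" for m
      using Q Qm by simp_all
    show "{z :: real ^ 'n. \<forall>i. 0 < z $ i} \<in> sets borel" by measurable
    show "AE \<omega> in M. Z \<omega> \<in> {z. \<forall>i. 0 < z $ i} \<longrightarrow> (\<forall>\<^sub>F m in sequentially. \<omega> \<in> ?Em m \<longleftrightarrow> \<omega> \<in> ?E)"
      using ev AE_space by eventually_elim auto
  qed
  then show ?thesis
  proof eventually_elim
    case (elim z)
    show ?case
    proof
      assume pos: "\<forall>i. 0 < z $ i"
      have "\<P>(\<omega> in M. Qm m z \<omega> \<bar> Z \<omega> \<in> cell_vec m z) =
          measure M (?Em m \<inter> (Z -` level_set (dyadic_index m) z \<inter> space M)) /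
          measure M (Z -` level_set (dyadic_index m) z \<inter> space M)" for m
      proof -
        have "Qm m (Z \<omega>) \<omega> = Qm m z \<omega>" if "Z \<omega> \<in> cell_vec m z" for \<omega>
          using that pos by (intro Qm_cong mem_cellD(2)) (auto simp: cell_vec_def)
        then have "{\<omega> \<in> space M. Qm m z \<omega> \<and> Z \<omega> \<in> cell_vec m z} = ?Em m \<inter> (Z -` cell_vec m z \<inter> space M)"
          by auto
        moreover have "{\<omega> \<in> space M. Z \<omega> \<in> cell_vec m z} = Z -` cell_vec m z \<inter> space M"
          by auto
        ultimately show ?thesis
          using pos by (simp add: cond_prob_def cell_vec_eq_level_set)
      qed
      then show "(\<lambda>m. \<P>(\<omega> in M. Qm m z \<omega> \<bar> Z \<omega> \<in> cell_vec m z)) \<longlonglongrightarrow> \<P>(\<omega> in \<kappa> z. Q (Z \<omega>) \<omega>)"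
        using elim pos by (simp add: space_kernel)
    qed
  qed
qed

lemma AE_scenario_tendsto:
  "AE z in distr M borel Z. (\<forall>i. 0 < z $ i) \<longrightarrow>
     (\<lambda>m. \<P>(\<omega> in M. scenario_event_blur G m t c z (\<Phi> \<omega>) \<bar> Z \<omega> \<in> cell_vec m z))
       \<longlonglongrightarrow> \<P>(\<omega> in \<kappa> z. scenario_event G t c (Z \<omega>) (\<Phi> \<omega>))"
proof (rule AE_cond_prob_tendsto_kernel)
  note [measurable] = random_sets_measurable[where t = t, OF Z_measurable_N, THEN borel_measurable_num_points_random_set]
  show "{\<omega> \<in> space N. scenario_event G t c (Z \<omega>) (\<Phi> \<omega>)} \<in> sets N"
    unfolding scenario_event_def by measurable
  show "{\<omega> \<in> space N. scenario_event_blur G m t c (Z \<omega>) (\<Phi> \<omega>)} \<in> sets N" for m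
    unfolding scenario_event_blur_def by measurable
  show "scenario_event_blur G m t c w (\<Phi> \<omega>) = scenario_event_blur G m t c z (\<Phi> \<omega>)"
    if "\<And>i. cell_index m (w $ i) = cell_index m (z $ i)" for m z w \<omega>
    using blur_cong[where G = G and t = t, OF that] by (simp add: scenario_event_blur_def)
  show "AE \<omega> in M. (\<forall>i. 0 < Z \<omega> $ i) \<longrightarrow> (\<forall>\<^sub>F m in sequentially.
      scenario_event_blur G m t c (Z \<omega>) (\<Phi> \<omega>) \<longleftrightarrow> scenario_event G t c (Z \<omega>) (\<Phi> \<omega>))"
    using AE_positive_eventually_exact
  proof eventually_elim
    case (elim \<omega>)
    show ?case
    proof
      assume "\<forall>i. 0 < Z \<omega> $ i"
      with elim show "\<forall>\<^sub>F m in sequentially.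
          scenario_event_blur G m t c (Z \<omega>) (\<Phi> \<omega>) \<longleftrightarrow> scenario_event G t c (Z \<omega>) (\<Phi> \<omega>)"
        by (elim impE conjE) (assumption, erule eventually_mono, simp add: scenario_event_def scenario_event_blur_def)
    qed
  qed
qed

lemma Pi2_Pi3_Int:
  "Pi2 G t (\<Phi> \<omega>) \<inter> B = \<Phi> \<omega> \<inter> (K_set G t (Z \<omega>) \<inter> B)"
  "Pi3 G t (\<Phi> \<omega>) \<inter> B = \<Phi> \<omega> \<inter> (B - (K_bar G t (Z \<omega>) \<union> K_set G t (Z \<omega>)))"
  by (auto simp: Pi1_def Pi2_def Pi3_def Z_eq)

lemma AE_Pi2_Pi3_tendsto:
  fixes k l :: nat
  assumes B: "\<And>j. j \<in> {1..l} \<Longrightarrow> B j \<in> sets L" and kl: "k \<le> l"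
  shows "AE z in distr M borel Z. (\<forall>i. 0 < z $ i) \<longrightarrow>
    (\<lambda>m. \<P>(\<omega> in M.
         (\<forall>j\<in>{1..k}. num_points (\<Phi> \<omega> \<inter> K_blur G m t z \<inter> B j) = of_nat (r j)) \<and>
         (\<forall>j\<in>{k<..l}. num_points (\<Phi> \<omega> \<inter> B j - (K_blur G m t z \<union> K_bar_blur G m t z)) = of_nat (r j))
         \<bar> Z \<omega> \<in> cell_vec m z))
      \<longlonglongrightarrow> \<P>(\<omega> in \<kappa> z.
         (\<forall>j\<in>{1..k}. num_points (Pi2 G t (\<Phi> \<omega>) \<inter> B j) = of_nat (r j)) \<and>
         (\<forall>j\<in>{k<..l}. num_points (Pi3 G t (\<Phi> \<omega>) \<inter> B j) = of_nat (r j)))"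
  unfolding Pi2_Pi3_Int
proof (rule AE_cond_prob_tendsto_kernel)
  note [measurable] = random_sets_measurable[where t = t, OF Z_measurable_N]
  have B1: "B j \<in> sets L" if "j \<in> {1..k}" for j
    by (rule B) (use kl that in auto)
  have B2: "B j \<in> sets L" if "j \<in> {k<..l}" for j
    by (rule B) (use that in auto)
  have count: "{\<omega> \<in> space N. num_points (\<Phi> \<omega> \<inter> K \<omega>) = x} \<in> sets N"
    if "{x \<in> space (N \<Otimes>\<^sub>M L). snd x \<in> K (fst x)} \<in> sets (N \<Otimes>\<^sub>M L)" for K x
    using borel_measurable_num_points_random_set[OF that] by measurable
  show "{\<omega> \<in> space N.
       (\<forall>j\<in>{1..k}. num_points (\<Phi> \<omega> \<inter> (K_set G t (Z \<omega>) \<inter> B j)) = of_nat (r j)) \<and>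
       (\<forall>j\<in>{k<..l}. num_points (\<Phi> \<omega> \<inter> (B j - (K_bar G t (Z \<omega>) \<union> K_set G t (Z \<omega>)))) = of_nat (r j))} \<in> sets N"
  proof (intro sets.sets_Collect_conj sets.sets_Collect_finite_All count)
    fix j assume "j \<in> {1..k}"
    note [measurable] = B1[OF this]
    show "{x \<in> space (N \<Otimes>\<^sub>M L). snd x \<in> K_set G t (Z (fst x)) \<inter> B j} \<in> sets (N \<Otimes>\<^sub>M L)"
      unfolding Int_iff by measurable
  next
    fix j assume "j \<in> {k<..l}"
    note [measurable] = B2[OF this]
    show "{x \<in> space (N \<Otimes>\<^sub>M L). snd x \<in> B j - (K_bar G t (Z (fst x)) \<union> K_set G t (Z (fst x)))} \<in> sets (N \<Otimes>\<^sub>M L)"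
      unfolding Diff_iff Un_iff by measurable
  qed auto
  show "{\<omega> \<in> space N.
       (\<forall>j\<in>{1..k}. num_points (\<Phi> \<omega> \<inter> K_blur G m t (Z \<omega>) \<inter> B j) = of_nat (r j)) \<and>
       (\<forall>j\<in>{k<..l}. num_points (\<Phi> \<omega> \<inter> B j - (K_blur G m t (Z \<omega>) \<union> K_bar_blur G m t (Z \<omega>))) = of_nat (r j))} \<in> sets N" for m
    unfolding Int_assoc Int_Diff
  proof (intro sets.sets_Collect_conj sets.sets_Collect_finite_All count)
    fix j assume "j \<in> {1..k}"
    note [measurable] = B1[OF this]
    show "{x \<in> space (N \<Otimes>\<^sub>M L). snd x \<in> K_blur G m t (Z (fst x)) \<inter> B j} \<in> sets (N \<Otimes>\<^sub>M L)"
      unfolding Int_iff by measurable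
  next
    fix j assume "j \<in> {k<..l}"
    note [measurable] = B2[OF this]
    show "{x \<in> space (N \<Otimes>\<^sub>M L). snd x \<in> B j - (K_blur G m t (Z (fst x)) \<union> K_bar_blur G m t (Z (fst x)))} \<in> sets (N \<Otimes>\<^sub>M L)"
      unfolding Diff_iff Un_iff by measurable
  qed auto
  show "((\<forall>j\<in>{1..k}. num_points (\<Phi> \<omega> \<inter> K_blur G m t w \<inter> B j) = of_nat (r j)) \<and>
       (\<forall>j\<in>{k<..l}. num_points (\<Phi> \<omega> \<inter> B j - (K_blur G m t w \<union> K_bar_blur G m t w)) = of_nat (r j))) =
      ((\<forall>j\<in>{1..k}. num_points (\<Phi> \<omega> \<inter> K_blur G m t z \<inter> B j) = of_nat (r j)) \<and>
       (\<forall>j\<in>{k<..l}. num_points (\<Phi> \<omega> \<inter> B j - (K_blur G m t z \<union> K_bar_blur G m t z)) = of_nat (r j)))"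
    if "\<And>i. cell_index m (w $ i) = cell_index m (z $ i)" for m z w \<omega>
    using blur_cong[where G = G and t = t, OF that] by simp
  show "AE \<omega> in M. (\<forall>i. 0 < Z \<omega> $ i) \<longrightarrow> (\<forall>\<^sub>F m in sequentially.
      ((\<forall>j\<in>{1..k}. num_points (\<Phi> \<omega> \<inter> K_blur G m t (Z \<omega>) \<inter> B j) = of_nat (r j)) \<and>
       (\<forall>j\<in>{k<..l}. num_points (\<Phi> \<omega> \<inter> B j - (K_blur G m t (Z \<omega>) \<union> K_bar_blur G m t (Z \<omega>))) = of_nat (r j))) =
      ((\<forall>j\<in>{1..k}. num_points (\<Phi> \<omega> \<inter> (K_set G t (Z \<omega>) \<inter> B j)) = of_nat (r j)) \<and>
       (\<forall>j\<in>{k<..l}. num_points (\<Phi> \<omega> \<inter> (B j - (K_bar G t (Z \<omega>) \<union> K_set G t (Z \<omega>)))) = of_nat (r j))))"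
    using AE_positive_eventually_exact
  proof eventually_elim
    case (elim \<omega>)
    show ?case
    proof
      assume "\<forall>i. 0 < Z \<omega> $ i"
      with elim have bar: "\<Phi> \<omega> \<inter> K_bar G t (Z \<omega>) = {}"
        and ev: "\<forall>\<^sub>F m in sequentially. \<Phi> \<omega> \<inter> K_bar_blur G m t (Z \<omega>) = {} \<and>
          \<Phi> \<omega> \<inter> K_blur G m t (Z \<omega>) = \<Phi> \<omega> \<inter> K_set G t (Z \<omega>)"
        by (auto elim: eventually_mono)
      from ev show "\<forall>\<^sub>F m in sequentially.
        ((\<forall>j\<in>{1..k}. num_points (\<Phi> \<omega> \<inter> K_blur G m t (Z \<omega>) \<inter> B j) = of_nat (r j)) \<and>
         (\<forall>j\<in>{k<..l}. num_points (\<Phi> \<omega> \<inter> B j - (K_blur G m t (Z \<omega>) \<union> K_bar_blur G m t (Z \<omega>))) = of_nat (r j))) =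
        ((\<forall>j\<in>{1..k}. num_points (\<Phi> \<omega> \<inter> (K_set G t (Z \<omega>) \<inter> B j)) = of_nat (r j)) \<and>
         (\<forall>j\<in>{k<..l}. num_points (\<Phi> \<omega> \<inter> (B j - (K_bar G t (Z \<omega>) \<union> K_set G t (Z \<omega>)))) = of_nat (r j)))"
      proof eventually_elim
        case (elim m)
        have "\<Phi> \<omega> \<inter> K_blur G m t (Z \<omega>) \<inter> B j = \<Phi> \<omega> \<inter> (K_set G t (Z \<omega>) \<inter> B j)" for j
          using elim by auto
        moreover have "\<Phi> \<omega> \<inter> B j - (K_blur G m t (Z \<omega>) \<union> K_bar_blur G m t (Z \<omega>)) =
            \<Phi> \<omega> \<inter> (B j - (K_bar G t (Z \<omega>) \<union> K_set G t (Z \<omega>)))" for j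
          using elim bar by blast
        ultimately show ?case by simp
      qed
    qed
  qed
qed

end

end

section \<open>Convergence along the dyadic cells\<close>

text \<open>For each scenario and each choice of \<open>k\<close>, \<open>l\<close>, sets and counts the exceptional null set is different.
  Scenarios are countably many because the index type is finite; for the second part it is enough to
  consider extensional families on \<open>{1..l}\<close>, of which there are countably many over a countable \<open>\<B>\<close>.\<close>

theorem theorem1:
  fixes G :: "('a::euclidean_space \<Rightarrow> real) set"
    and MF :: "'c measure" and F :: "'c \<Rightarrow> 'a \<Rightarrow> real"
    and M :: "'w measure" and \<Phi> :: "'w \<Rightarrow> 'a storm set"
    and L :: "'a storm measure"
    and t :: "'n::finite \<Rightarrow> 'a"
    and Z :: "'w \<Rightarrow> real ^ 'n"
    and \<kappa> :: "real ^ 'n \<Rightarrow> 'w measure"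
  assumes countable_G: "countable G"
    and measurable_G: "\<And>f. f \<in> G \<Longrightarrow> f \<in> borel_measurable borel"
    and nonneg_G: "\<And>f x. f \<in> G \<Longrightarrow> 0 \<le> f x"
    and prob_F: "prob_space MF"
    and random_F: "F \<in> MF \<rightarrow>\<^sub>M count_space G"
    and integral_F: "(\<integral>\<^sup>+\<omega>. (\<integral>\<^sup>+x. ennreal (F \<omega> x) \<partial>lborel) \<partial>MF) = 1"
    and L_eq: "L = storm_intensity (distr MF (count_space G) F)"
    and prob_M: "prob_space M"
    and poisson: "poisson_point_process M G L \<Phi>"
    and Z_eq: "Z = (\<lambda>\<omega>. max_vec t (\<Phi> \<omega>))"
    and kernel: "regular_cond_prob M (process_algebra M L \<Phi>) borel Z \<kappa>"
  shows "\<forall>\<B>. countable \<B> \<and> \<B> \<subseteq> sets L \<longrightarrow>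
    (AE z in distr M borel Z. (\<forall>i. 0 < z $ i) \<longrightarrow>
       (\<forall>c\<in>scenarios.
          (\<lambda>m. \<P>(\<omega> in M. scenario_event_blur G m t c z (\<Phi> \<omega>) \<bar> Z \<omega> \<in> cell_vec m z))
            \<longlonglongrightarrow> \<P>(\<omega> in \<kappa> z. scenario_event G t c (Z \<omega>) (\<Phi> \<omega>)))
       \<and> (\<forall>(k::nat) (l::nat) (B :: nat \<Rightarrow> 'a storm set) (r :: nat \<Rightarrow> nat).
          k \<le> l \<and> (\<forall>j\<in>{1..l}. B j \<in> \<B>) \<longrightarrow>
          (\<lambda>m. \<P>(\<omega> in M.
               (\<forall>j\<in>{1..k}. num_points (\<Phi> \<omega> \<inter> K_blur G m t z \<inter> B j) = of_nat (r j)) \<and>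
               (\<forall>j\<in>{k<..l}. num_points (\<Phi> \<omega> \<inter> B j - (K_blur G m t z \<union> K_bar_blur G m t z))
                             = of_nat (r j))
               \<bar> Z \<omega> \<in> cell_vec m z))
            \<longlonglongrightarrow> \<P>(\<omega> in \<kappa> z.
               (\<forall>j\<in>{1..k}. num_points (Pi2 G t (\<Phi> \<omega>) \<inter> B j) = of_nat (r j)) \<and>
               (\<forall>j\<in>{k<..l}. num_points (Pi3 G t (\<Phi> \<omega>) \<inter> B j) = of_nat (r j)))))"
proof (intro allI impI, elim conjE)
  fix \<B> :: "'a storm set set"
  assume \<B>: "countable \<B>" "\<B> \<subseteq> sets L"
  define PF where "PF = distr MF (count_space G) F"
  interpret storm_model M G PF L \<Phi>
  proof (intro storm_model.intro prob_M storm_model_axioms.intro countable_G measurable_G nonneg_G poisson)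
    show "prob_space PF"
      unfolding PF_def using prob_F random_F by (rule prob_space.prob_space_distr)
    show "(\<integral>\<^sup>+f. (\<integral>\<^sup>+x. ennreal (f x) \<partial>lborel) \<partial>PF) = 1"
      unfolding PF_def using random_F integral_F by (subst nn_integral_distr) auto
  qed (simp_all add: PF_def L_eq)
  have scenario: "AE z in distr M borel Z. \<forall>c. (\<forall>i. 0 < z $ i) \<longrightarrow>
      (\<lambda>m. \<P>(\<omega> in M. scenario_event_blur G m t c z (\<Phi> \<omega>) \<bar> Z \<omega> \<in> cell_vec m z))
        \<longlonglongrightarrow> \<P>(\<omega> in \<kappa> z. scenario_event G t c (Z \<omega>) (\<Phi> \<omega>))"
    unfolding AE_all_countable by (intro allI AE_scenario_tendsto[OF Z_eq kernel])
  let ?lim = "\<lambda>z (k::nat) (l::nat) B r. (\<lambda>m. \<P>(\<omega> in M.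
         (\<forall>j\<in>{1..k}. num_points (\<Phi> \<omega> \<inter> K_blur G m t z \<inter> B j) = of_nat (r j)) \<and>
         (\<forall>j\<in>{k<..l}. num_points (\<Phi> \<omega> \<inter> B j - (K_blur G m t z \<union> K_bar_blur G m t z)) = of_nat (r j))
         \<bar> Z \<omega> \<in> cell_vec m z))
      \<longlonglongrightarrow> \<P>(\<omega> in \<kappa> z.
         (\<forall>j\<in>{1..k}. num_points (Pi2 G t (\<Phi> \<omega>) \<inter> B j) = of_nat (r j)) \<and>
         (\<forall>j\<in>{k<..l}. num_points (Pi3 G t (\<Phi> \<omega>) \<inter> B j) = of_nat (r j)))"
  let ?PB = "\<lambda>l::nat. {1..l} \<rightarrow>\<^sub>E \<B>" and ?Pr = "\<lambda>l::nat. {1..l} \<rightarrow>\<^sub>E (UNIV :: nat set)"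
  have "AE z in distr M borel Z. \<forall>l::nat. \<forall>k\<in>{..l}. \<forall>B\<in>?PB l. \<forall>r\<in>?Pr l. (\<forall>i. 0 < z $ i) \<longrightarrow> ?lim z k l B r"
  proof (rule AE_all_countable[THEN iffD2], rule allI)
    fix l :: nat
    have k: "countable {..l}" and PB: "countable (?PB l)" and Pr: "countable (?Pr l)"
      using \<B> by (auto intro!: countable_PiE)
    show "AE z in distr M borel Z. \<forall>k\<in>{..l}. \<forall>B\<in>?PB l. \<forall>r\<in>?Pr l. (\<forall>i. 0 < z $ i) \<longrightarrow> ?lim z k l B r"
      unfolding AE_ball_countable[OF k] AE_ball_countable[OF PB] AE_ball_countable[OF Pr]
      by (intro ballI AE_Pi2_Pi3_tendsto[OF Z_eq kernel]) (use \<B> in auto)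
  qed
  with scenario show "AE z in distr M borel Z. (\<forall>i. 0 < z $ i) \<longrightarrow>
       (\<forall>c\<in>scenarios.
          (\<lambda>m. \<P>(\<omega> in M. scenario_event_blur G m t c z (\<Phi> \<omega>) \<bar> Z \<omega> \<in> cell_vec m z))
            \<longlonglongrightarrow> \<P>(\<omega> in \<kappa> z. scenario_event G t c (Z \<omega>) (\<Phi> \<omega>)))
       \<and> (\<forall>(k::nat) (l::nat) (B :: nat \<Rightarrow> 'a storm set) (r :: nat \<Rightarrow> nat).
          k \<le> l \<and> (\<forall>j\<in>{1..l}. B j \<in> \<B>) \<longrightarrow> ?lim z k l B r)"
  proof eventually_elim
    case (elim z)
    show ?case
    proof (intro impI conjI ballI allI)
      fix c assume "\<forall>i. 0 < z $ i"
      with elim(1) show "(\<lambda>m. \<P>(\<omega> in M. scenario_event_blur G m t c z (\<Phi> \<omega>) \<bar> Z \<omega> \<in> cell_vec m z))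
            \<longlonglongrightarrow> \<P>(\<omega> in \<kappa> z. scenario_event G t c (Z \<omega>) (\<Phi> \<omega>))"
        by blast
    next
      fix k l :: nat and B :: "nat \<Rightarrow> 'a storm set" and r :: "nat \<Rightarrow> nat"
      assume pos: "\<forall>i. 0 < z $ i" and B: "k \<le> l \<and> (\<forall>j\<in>{1..l}. B j \<in> \<B>)"
      let ?B = "restrict B {1..l}" and ?r = "restrict r {1..l}"
      have "?lim z k l ?B ?r"
        using B by (intro elim(2)[rule_format] pos[rule_format]) auto
      moreover have "?B j = B j" "?r j = r j" if "j \<in> {1..k}" for j
        using that B by auto
      moreover have "?B j = B j" "?r j = r j" if "j \<in> {k<..l}" for j
        using that by auto
      ultimately show "?lim z k l B r"
        by (simp only: cong: ball_cong)
    qed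
  qed
qed

end
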